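(* Let $\mathfrak g=V=\mathfrak{sl}(2,\mathbb C)$, with $V$ the adjoint representation, let $\{e,f,h\}$ be the standard basis and $\{e',f',h'\}$ the dual basis of $V^*$. Then the invariant ring $P_0^{\mathfrak{sl}(2,\mathbb C)}=\mathbb C[\beta_0^{e},\beta_0^{f},\beta_0^{h},\gamma_0^{e'},\gamma_0^{f'},\gamma_0^{h'}]^{\mathfrak{sl}(2,\mathbb C)}$ is generated as a ring (unital $\mathbb C$-algebra) by the three elements $$v^{e}=4(\gamma_0^{h'}\gamma_0^{h'}+\gamma_0^{e'}\gamma_0^{f'}),\qquad v^{f}=-\tfrac1{16}(\beta_0^{h}\beta_0^{h}+4\beta_0^{e}\beta_0^{f}),\qquad v^{h}=\beta_0^{h}\gamma_0^{h'}+\beta_0^{e}\gamma_0^{e'}+\beta_0^{f}\gamma_0^{f'}.$$ Consequently, the invariant ring $P^{\Theta_+}=P^{\mathfrak{sl}(2,\mathbb C)\otimes\mathbb C[t]}$ is generated by $v^e,v^f,v^h$ as a $\partial$-ring.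
   Context: The standard basis $e,f,h$ of $\mathfrak{sl}(2,\mathbb C)$ satisfies $[e,f]=h$, $[h,e]=2e$, $[h,f]=-2f$. $\rho(u)(x)=[u,x]$ is the adjoint action on $V=\mathfrak{sl}(2,\mathbb C)$ and $\rho^*$ is the dual (coadjoint) action on $V^*$. $P=\mathbb C[\beta_k^{x},\gamma_k^{x'}\mid x\in V,\ x'\in V^*,\ k\ge 0]$ is the polynomial ring where $\beta_k^{x}$ is linear in $x$ and $\gamma_k^{x'}$ is linear in $x'$; that is, it is the polynomial ring in the variables $\beta_k^{e},\beta_k^{f},\beta_k^{h},\gamma_k^{e'},\gamma_k^{f'},\gamma_k^{h'}$, $k\ge0$. (It is the associated graded ring of the $\beta\gamma$-system $S(V)$, with $\beta_k^x,\gamma_k^{x'}$ the images of $\partial^k\beta^x(z),\partial^k\gamma^{x'}(z)$.) It carries the derivation $\partial$ with $\partial\beta_k^{x}=\beta_{k+1}^{x}$, $\partial\gamma_k^{x'}=\gamma_{k+1}^{x'}$. The Lie algebra $\mathfrak{sl}(2,\mathbb C)\otimes\mathbb C[t]$ acts on $P$ by derivations: for $u\in\mathfrak{sl}(2,\mathbb C)$ and $n\ge 0$, $u\otimes t^n$ acts by $$\beta_k^{x}\mapsto C_k^n\,\beta_{k-n}^{\rho(u)(x)},\qquad \gamma_k^{x'}\mapsto C_k^n\,\gamma_{k-n}^{\rho^*(u)(x')},$$ where $C_k^0=1$, $C_k^n=k(k-1)\cdots(k-n+1)$ for $1\le n\le k$, and $C_k^n=0$ for $n>k$. $P^{\Theta_+}=P^{\mathfrak{sl}(2,\mathbb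 C)\otimes\mathbb C[t]}$ is the subring of elements annihilated by all these derivations; it is closed under $\partial$. $P_0=\mathbb C[\beta_0^{x},\gamma_0^{x'}\mid x\in V,x'\in V^*]\cong \mathrm{Sym}(V\oplus V^* )$, and $P_0^{\mathfrak{sl}(2,\mathbb C)}$ is the subring annihilated by $\mathfrak{sl}(2,\mathbb C)=\mathfrak{sl}(2,\mathbb C)\otimes 1$. A collection $\{a_i\}_{i\in I}$ generates a ring $R$ with derivation $\partial$ as a $\partial$-ring if $\{\partial^k a_i\mid i\in I,k\ge0\}$ generates $R$ as a ring (unital $\mathbb C$-algebra). *)

theory Defs
  imports "HOL-Analysis.Analysis" "HOL-Library.Poly_Mapping"
begin

text \<open>Polynomials are the monoid algebra of the free commutative monoid on the variables.\<close>

type_synonym 'v cpoly = "('v \<Rightarrow>\<^sub>0 nat) \<Rightarrow>\<^sub>0 complex"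

definition Const :: "complex \<Rightarrow> 'v cpoly"
  where "Const c = Poly_Mapping.single 0 c"

definition Var :: "'v \<Rightarrow> 'v cpoly"
  where "Var v = Poly_Mapping.single (Poly_Mapping.single v 1) 1"

definition subalgebra :: "'v cpoly set \<Rightarrow> bool"
  where "subalgebra A \<longleftrightarrow>
    range Const \<subseteq> A \<and> (\<forall>p\<in>A. \<forall>q\<in>A. p + q \<in> A) \<and> (\<forall>p\<in>A. \<forall>q\<in>A. p * q \<in> A)"

definition generates_ring :: "'v cpoly set \<Rightarrow> 'v cpoly set \<Rightarrow> bool"
  where "generates_ring S R \<longleftrightarrow> subalgebra hull S = R"

definition generates_diff_ring ::
    "('v cpoly \<Rightarrow> 'v cpoly) \<Rightarrow> 'v cpoly set \<Rightarrow> 'v cpoly set \<Rightarrow> bool"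
  where "generates_diff_ring D S R \<longleftrightarrow> generates_ring {(D ^^ k) a | k a. a \<in> S} R"

definition derivation :: "('v cpoly \<Rightarrow> 'v cpoly) \<Rightarrow> bool"
  where "derivation D \<longleftrightarrow> (\<forall>p q. D (p + q) = D p + D q) \<and> (\<forall>c. D (Const c) = 0) \<and>
    (\<forall>p q. D (p * q) = D p * q + p * D q)"

text \<open>The derivation with prescribed values \<open>\<phi> v\<close> on the variables, that is
  \<open>\<Sum>v. \<phi> v * (\<partial>/\<partial>v)\<close>, written out on monomials. The lemmas below show that it is
  the unique derivation with these values.\<close>

definition monom_der :: "('v \<Rightarrow> 'v cpoly) \<Rightarrow> ('v \<Rightarrow>\<^sub>0 nat) \<Rightarrow> 'v cpoly"
  where "monom_der \<phi> m = (\<Sum>v\<in>Poly_Mapping.keys m.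
    Poly_Mapping.single (m - Poly_Mapping.single v 1) (of_nat (Poly_Mapping.lookup m v)) * \<phi> v)"

definition var_der :: "('v \<Rightarrow> 'v cpoly) \<Rightarrow> 'v cpoly \<Rightarrow> 'v cpoly"
  where "var_der \<phi> p =
    (\<Sum>m\<in>Poly_Mapping.keys p. Const (Poly_Mapping.lookup p m) * monom_der \<phi> m)"

lemma Const_0 [simp]: "Const 0 = 0"
  by (simp add: Const_def)

lemma Const_1 [simp]: "Const 1 = 1"
  by (simp add: Const_def)

lemma Const_add: "Const (a + b) = Const a + Const b"
  by (simp add: Const_def single_add)

lemma Const_minus: "Const (- a) = - Const a"
  by (simp add: Const_def single_uminus)

lemma Const_mult: "Const (a * b) = Const a * Const b"
  by (simp add: Const_def mult_single)

lemma cpoly_induct [case_names add Const Var mult]: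
  assumes add: "\<And>p q. P p \<Longrightarrow> P q \<Longrightarrow> P (p + q)"
    and Const: "\<And>c. P (Const c)" and Var: "\<And>v. P (Var v)"
    and mult: "\<And>p q. P p \<Longrightarrow> P q \<Longrightarrow> P (p * q)"
  shows "P (p :: 'v cpoly)"
proof -
  have pow: "P (Poly_Mapping.single (Poly_Mapping.single v n) 1)" for v n
  proof (induction n)
    case 0
    show ?case using Const[of 1] by (simp add: Const_def)
  next
    case (Suc n)
    have "Poly_Mapping.single (Poly_Mapping.single v (Suc n)) 1 =
        Var v * Poly_Mapping.single (Poly_Mapping.single v n) (1::complex)"
      by (simp add: Var_def mult_single flip: single_add)
    then show ?case using mult[OF Var Suc] by simp
  qed
  have mon: "P (Poly_Mapping.single m 1)" for m :: "'v \<Rightarrow>\<^sub>0 nat"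
  proof (induction m rule: update_induct)
    case const
    show ?case using Const[of 1] by (simp add: Const_def)
  next
    case (update f a b)
    have "Poly_Mapping.update a b f = Poly_Mapping.single a b + f"
      using update(1) by (intro poly_mapping_eqI)
        (auto simp: lookup_update lookup_add lookup_single in_keys_iff)
    then have "Poly_Mapping.single (Poly_Mapping.update a b f) (1::complex) =
        Poly_Mapping.single (Poly_Mapping.single a b) 1 * Poly_Mapping.single f 1"
      by (simp add: mult_single)
    then show ?case using mult[OF pow update(3)] by simp
  qed
  show ?thesis
  proof (induction p rule: update_induct)
    case const
    show ?case using Const[of 0] by simp
  next
    case (update f a b)
    have "Poly_Mapping.update a b f = Const b * Poly_Mapping.single a 1 + f"
      using update(1) by (intro poly_mapping_eqI)
        (auto simp: Const_def mult_single lookup_update lookup_add lookup_single in_keys_iff)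
    then show ?case using add[OF mult[OF Const mon] update(3)] by simp
  qed
qed

lemma monom_der_superset:
  assumes "finite X" "Poly_Mapping.keys m \<subseteq> X"
  shows "monom_der \<phi> m = (\<Sum>v\<in>X.
    Poly_Mapping.single (m - Poly_Mapping.single v 1) (of_nat (Poly_Mapping.lookup m v)) * \<phi> v)"
  unfolding monom_der_def using assms
  by (intro sum.mono_neutral_left) (auto simp: in_keys_iff)

lemma var_der_superset:
  assumes "finite X" "Poly_Mapping.keys p \<subseteq> X"
  shows "var_der \<phi> p = (\<Sum>m\<in>X. Const (Poly_Mapping.lookup p m) * monom_der \<phi> m)"
  unfolding var_der_def using assms
  by (intro sum.mono_neutral_left) (auto simp: in_keys_iff)

lemma var_der_add: "var_der \<phi> (p + q) = var_der \<phi> p + var_der \<phi> q"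
proof -
  let ?X = "Poly_Mapping.keys p \<union> Poly_Mapping.keys q"
  have "Poly_Mapping.keys (p + q) \<subseteq> ?X" by (rule keys_add)
  then show ?thesis
    by (simp add: var_der_superset[where X = ?X] lookup_add Const_add distrib_right sum.distrib)
qed

lemma var_der_single: "var_der \<phi> (Poly_Mapping.single m c) = Const c * monom_der \<phi> m"
  by (simp add: var_der_superset[where X = "{m}"])

lemma monom_der_add:
  "monom_der \<phi> (m + n) =
    monom_der \<phi> m * Poly_Mapping.single n 1 + Poly_Mapping.single m 1 * monom_der \<phi> n"
proof -
  let ?s = "Poly_Mapping.single :: _ \<Rightarrow> complex \<Rightarrow> 'a cpoly"
  let ?X = "Poly_Mapping.keys m \<union> Poly_Mapping.keys n"
  have l: "?s (a + b - Poly_Mapping.single v 1) (of_nat (Poly_Mapping.lookup a v)) =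
      ?s (a - Poly_Mapping.single v 1) (of_nat (Poly_Mapping.lookup a v)) * ?s b 1" for a b v
  proof (cases "Poly_Mapping.lookup a v = 0")
    case False
    then have "a + b - Poly_Mapping.single v 1 = a - Poly_Mapping.single v 1 + b"
      by (intro poly_mapping_eqI) (auto simp: lookup_add lookup_minus lookup_single when_def)
    then show ?thesis by (simp add: mult_single)
  qed simp
  have "?s (m + n - Poly_Mapping.single v 1) (of_nat (Poly_Mapping.lookup (m + n) v)) * \<phi> v =
      ?s (m - Poly_Mapping.single v 1) (of_nat (Poly_Mapping.lookup m v)) * \<phi> v * ?s n 1 +
      ?s m 1 * (?s (n - Poly_Mapping.single v 1) (of_nat (Poly_Mapping.lookup n v)) * \<phi> v)" for v
  proof -
    have "?s (m + n - Poly_Mapping.single v 1) (of_nat (Poly_Mapping.lookup (m + n) v)) =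
        ?s (m + n - Poly_Mapping.single v 1) (of_nat (Poly_Mapping.lookup m v)) +
        ?s (n + m - Poly_Mapping.single v 1) (of_nat (Poly_Mapping.lookup n v))"
      by (simp add: lookup_add single_add add.commute)
    then show ?thesis by (simp only: l) (simp add: algebra_simps)
  qed
  then show ?thesis
    using keys_add[of m n]
    by (simp add: monom_der_superset[where X = ?X] sum.distrib sum_distrib_left sum_distrib_right)
qed

lemma cpoly_additive_induct [case_names single add]:
  assumes "\<And>m c. P (Poly_Mapping.single m c)" "\<And>p q. P p \<Longrightarrow> P q \<Longrightarrow> P (p + q)"
  shows "P (p :: 'v cpoly)"
proof (induction p rule: update_induct)
  case const
  show ?case using assms(1)[of 0 0] by simp
next
  case (update f a b)
  have "Poly_Mapping.update a b f = Poly_Mapping.single a b + f"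
    using update(1) by (intro poly_mapping_eqI)
      (auto simp: lookup_update lookup_add lookup_single in_keys_iff)
  then show ?case using assms update(3) by simp
qed

lemma var_der_mult: "var_der \<phi> (p * q) = var_der \<phi> p * q + p * var_der \<phi> q"
proof (induction p rule: cpoly_additive_induct)
  case (single m c)
  show ?case
  proof (induction q rule: cpoly_additive_induct)
    case (single n d)
    have s: "Poly_Mapping.single k a = Const a * Poly_Mapping.single k 1" for k and a :: complex
      by (simp add: Const_def mult_single)
    have "var_der \<phi> (Poly_Mapping.single m c * Poly_Mapping.single n d) =
        Const c * Const d * monom_der \<phi> (m + n)"
      by (simp add: mult_single var_der_single Const_mult)
    also have "\<dots> = Const c * monom_der \<phi> m * (Const d * Poly_Mapping.single n 1) +
        Const c * Poly_Mapping.single m 1 * (Const d * monom_der \<phi> n)"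
      by (simp add: monom_der_add algebra_simps)
    finally show ?case by (simp only: s[symmetric] var_der_single)
  qed (simp add: var_der_add algebra_simps)
qed (simp add: var_der_add algebra_simps)

lemma var_der_Const [simp]: "var_der \<phi> (Const c) = 0"
  by (simp add: Const_def var_der_single monom_der_def)

lemma var_der_Var [simp]: "var_der \<phi> (Var v) = \<phi> v"
  by (simp add: Var_def var_der_single monom_der_def)

lemma derivation_var_der: "derivation (var_der \<phi>)"
  by (simp add: derivation_def var_der_add var_der_mult)

lemma derivation_eqI:
  assumes "derivation D" "derivation D'" "\<And>v. D (Var v) = D' (Var v)"
  shows "D = D'"
proof
  fix p show "D p = D' p"
    by (induction p rule: cpoly_induct) (use assms in \<open>auto simp: derivation_def\<close>)
qed

definition sl2 :: "(complex^2^2) set"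
  where "sl2 = {A. trace A = 0}"

definition bracket :: "complex^2^2 \<Rightarrow> complex^2^2 \<Rightarrow> complex^2^2"
  where "bracket A B = A ** B - B ** A"

datatype idx = Ei | Fi | Hi

fun basis :: "idx \<Rightarrow> complex^2^2" where
  "basis Ei = vector [vector [0, 1], vector [0, 0]]"
| "basis Fi = vector [vector [0, 0], vector [1, 0]]"
| "basis Hi = vector [vector [1, 0], vector [0, - 1]]"

text \<open>Elements of the dual space are represented by functions on matrices, of which only the
  restriction to \<^const>\<open>sl2\<close> matters. The dual basis \<open>e'\<close>, \<open>f'\<close>, \<open>h'\<close> reads off coordinates.\<close>

definition sl2_dual :: "(complex^2^2 \<Rightarrow> complex) set"
  where "sl2_dual = {l. (\<forall>x\<in>sl2. \<forall>y\<in>sl2. l (x + y) = l x + l y) \<and>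
    (\<forall>c. \<forall>x\<in>sl2. l (mat c ** x) = c * l x)}"

fun dual_basis :: "idx \<Rightarrow> complex^2^2 \<Rightarrow> complex" where
  "dual_basis Ei x = x $ 1 $ 2"
| "dual_basis Fi x = x $ 2 $ 1"
| "dual_basis Hi x = x $ 1 $ 1"

definition coad :: "complex^2^2 \<Rightarrow> (complex^2^2 \<Rightarrow> complex) \<Rightarrow> complex^2^2 \<Rightarrow> complex"
  where "coad u l = (\<lambda>y. - l (bracket u y))"

lemma bracket_basis:
  "bracket (basis Ei) (basis Fi) = basis Hi"
  "bracket (basis Hi) (basis Ei) = mat 2 ** basis Ei"
  "bracket (basis Hi) (basis Fi) = mat (- 2) ** basis Fi"
  by (simp_all add: bracket_def vec_eq_iff forall_2 matrix_matrix_mult_def sum_2 mat_def)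

lemma basis_sl2: "basis b \<in> sl2"
  by (cases b) (simp_all add: sl2_def trace_def sum_2)

lemma dual_basis_basis: "dual_basis b (basis b') = (if b = b' then 1 else 0)"
  by (cases b; cases b') simp_all

lemma sl2_expand:
  assumes "x \<in> sl2"
  shows "x = mat (dual_basis Ei x) ** basis Ei + mat (dual_basis Fi x) ** basis Fi +
    mat (dual_basis Hi x) ** basis Hi"
  using assms
  by (simp add: sl2_def trace_def vec_eq_iff forall_2 matrix_matrix_mult_def sum_2 mat_def
      add_eq_0_iff)

lemma dual_basis_sl2_dual: "dual_basis b \<in> sl2_dual"
  by (cases b) (simp_all add: sl2_dual_def matrix_matrix_mult_def sum_2 mat_def)

lemma bracket_sl2: "bracket u x \<in> sl2"
  by (simp add: bracket_def sl2_def trace_def matrix_matrix_mult_def sum_2)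

lemma coad_sl2_dual:
  assumes "l \<in> sl2_dual"
  shows "coad u l \<in> sl2_dual"
proof -
  have "bracket u (x + y) = bracket u x + bracket u y" for x y
    by (simp add: bracket_def vec_eq_iff forall_2 matrix_matrix_mult_def sum_2 algebra_simps)
  moreover have "bracket u (mat c ** x) = mat c ** bracket u x" for c x
    by (simp add: bracket_def vec_eq_iff forall_2 matrix_matrix_mult_def sum_2 mat_def
        algebra_simps)
  ultimately show ?thesis
    using assms by (simp add: sl2_dual_def coad_def bracket_sl2)
qed

text \<open>\<open>Beta k b\<close> stands for \<open>\<beta>\<^sub>k\<close> with the basis vector \<open>b\<close> as superscript, and
  \<open>Gamma k b\<close> for \<open>\<gamma>\<^sub>k\<close> with the dual basis vector of \<open>b\<close> as superscript. The ring \<open>P\<close> is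
  the whole type \<open>var cpoly\<close>.\<close>

datatype var = Beta nat idx | Gamma nat idx

definition beta :: "nat \<Rightarrow> complex^2^2 \<Rightarrow> var cpoly"
  where "beta k x = Const (dual_basis Ei x) * Var (Beta k Ei) +
    Const (dual_basis Fi x) * Var (Beta k Fi) + Const (dual_basis Hi x) * Var (Beta k Hi)"

definition gamma :: "nat \<Rightarrow> (complex^2^2 \<Rightarrow> complex) \<Rightarrow> var cpoly"
  where "gamma k l = Const (l (basis Ei)) * Var (Gamma k Ei) +
    Const (l (basis Fi)) * Var (Gamma k Fi) + Const (l (basis Hi)) * Var (Gamma k Hi)"

fun shift_var :: "var \<Rightarrow> var cpoly" where
  "shift_var (Beta k b) = Var (Beta (Suc k) b)"
| "shift_var (Gamma k b) = Var (Gamma (Suc k) b)"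

definition del :: "var cpoly \<Rightarrow> var cpoly"
  where "del = var_der shift_var"

definition Ccoeff :: "nat \<Rightarrow> nat \<Rightarrow> complex"
  where "Ccoeff k n = (if n \<le> k then of_nat (\<Prod>i<n. k - i) else 0)"

text \<open>The truncated subtraction \<open>k - n\<close> is harmless: the coefficient vanishes for \<open>n > k\<close>.\<close>

fun act_var :: "complex^2^2 \<Rightarrow> nat \<Rightarrow> var \<Rightarrow> var cpoly" where
  "act_var u n (Beta k b) = Const (Ccoeff k n) * beta (k - n) (bracket u (basis b))"
| "act_var u n (Gamma k b) = Const (Ccoeff k n) * gamma (k - n) (coad u (dual_basis b))"

definition act :: "complex^2^2 \<Rightarrow> nat \<Rightarrow> var cpoly \<Rightarrow> var cpoly"
  where "act u n = var_der (act_var u n)"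

definition P0 :: "var cpoly set"
  where "P0 = subalgebra hull (beta 0 ` sl2 \<union> gamma 0 ` sl2_dual)"

definition P0_sl2_invariants :: "var cpoly set"
  where "P0_sl2_invariants = {p \<in> P0. \<forall>u\<in>sl2. act u 0 p = 0}"

definition P_Theta_invariants :: "var cpoly set"
  where "P_Theta_invariants = {p. \<forall>u\<in>sl2. \<forall>n. act u n p = 0}"

lemma beta_basis: "beta k (basis b) = Var (Beta k b)"
  by (cases b) (simp_all add: beta_def)

lemma gamma_dual_basis: "gamma k (dual_basis b) = Var (Gamma k b)"
  by (cases b) (simp_all add: gamma_def)

lemma del_beta: "del (beta k x) = beta (Suc k) x"
  by (simp add: del_def beta_def var_der_add var_der_mult)

lemma del_gamma: "del (gamma k l) = gamma (Suc k) l"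
  by (simp add: del_def gamma_def var_der_add var_der_mult)

lemma act_beta:
  assumes "x \<in> sl2"
  shows "act u n (beta k x) = Const (Ccoeff k n) * beta (k - n) (bracket u x)"
proof -
  have *: "dual_basis b (bracket u x) =
      dual_basis Ei x * dual_basis b (bracket u (basis Ei)) +
      dual_basis Fi x * dual_basis b (bracket u (basis Fi)) +
      dual_basis Hi x * dual_basis b (bracket u (basis Hi))" for b
  proof -
    have "x $ 2 $ 2 = - (x $ 1 $ 1)"
      using assms by (simp add: sl2_def trace_def sum_2 add_eq_0_iff)
    then show ?thesis
      by (cases b) (simp_all add: bracket_def matrix_matrix_mult_def sum_2 algebra_simps)
  qed
  show ?thesis
    unfolding act_def beta_def *
    by (simp add: var_der_add var_der_mult beta_def Const_add Const_mult
        del: basis.simps dual_basis.simps) (simp only: algebra_simps)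
qed

lemma act_gamma:
  assumes "l \<in> sl2_dual"
  shows "act u n (gamma k l) = Const (Ccoeff k n) * gamma (k - n) (coad u l)"
proof -
  have add: "l (x + y) = l x + l y" if "x \<in> sl2" "y \<in> sl2" for x y
    using assms that by (simp add: sl2_dual_def)
  have scale: "l (mat c ** x) = c * l x" if "x \<in> sl2" for c x
    using assms that by (simp add: sl2_dual_def)
  have scale_sl2: "mat c ** x \<in> sl2" if "x \<in> sl2" for c x
    using that by (simp add: sl2_def trace_def matrix_matrix_mult_def sum_2 mat_def
        flip: distrib_left)
  have add_sl2: "x + y \<in> sl2" if "x \<in> sl2" "y \<in> sl2" for x y
    using that by (simp add: sl2_def trace_add)
  have l: "l x = dual_basis Ei x * l (basis Ei) + dual_basis Fi x * l (basis Fi) +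
      dual_basis Hi x * l (basis Hi)" if "x \<in> sl2" for x
  proof -
    have "l x = l (mat (dual_basis Ei x) ** basis Ei + mat (dual_basis Fi x) ** basis Fi +
        mat (dual_basis Hi x) ** basis Hi)"
      using sl2_expand[OF that] by simp
    then show ?thesis by (simp only: add scale basis_sl2 scale_sl2 add_sl2)
  qed
  have *: "coad u l y = l (basis Ei) * coad u (dual_basis Ei) y +
      l (basis Fi) * coad u (dual_basis Fi) y + l (basis Hi) * coad u (dual_basis Hi) y" for y
    unfolding coad_def l[OF bracket_sl2[of u y]]
    by (simp add: algebra_simps del: basis.simps dual_basis.simps)
  show ?thesis
    unfolding act_def gamma_def *
    by (simp add: var_der_add var_der_mult gamma_def Const_add Const_mult
        del: basis.simps dual_basis.simps) (simp only: algebra_simps)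
qed

abbreviation beta0 :: "idx \<Rightarrow> var cpoly" where "beta0 b \<equiv> beta 0 (basis b)"
abbreviation gamma0 :: "idx \<Rightarrow> var cpoly" where "gamma0 b \<equiv> gamma 0 (dual_basis b)"

definition v_e :: "var cpoly"
  where "v_e = Const 4 * (gamma0 Hi * gamma0 Hi + gamma0 Ei * gamma0 Fi)"

definition v_f :: "var cpoly"
  where "v_f = Const (- 1 / 16) * (beta0 Hi * beta0 Hi + Const 4 * (beta0 Ei * beta0 Fi))"

definition v_h :: "var cpoly"
  where "v_h = beta0 Hi * gamma0 Hi + beta0 Ei * gamma0 Ei + beta0 Fi * gamma0 Fi"

end

theory Submission
  imports Defs
begin

text \<open>An element \<open>p\<close> annihilated by all \<open>e \<otimes> t\<^sup>n\<close> and \<open>f \<otimes> t\<^sup>n\<close> is, as a function of a pair \<open>X, Y\<close> of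
  arcs in the traceless matrices, constant on orbits of \<open>SL\<^sub>2\<close> over the power series ring. Let
  \<open>a, b, c\<close> be, up to scalars, the entries of the Gram matrix of \<open>X, Y\<close>. If \<open>c\<close> has nonzero constant term, it has
  a square root \<open>r\<close>, and in the basis \<open>X w, w\<close> with \<open>Y w = - r w\<close> a generic pair takes the form
  \<open>X = e + a f\<close>, \<open>Y = b f + r h\<close>. The coefficients of \<open>r\<close> are polynomials in those of \<open>c\<close> up to
  powers of \<open>r\<^sub>0\<close>, and the choice of sign of \<open>r\<close> is immaterial, so \<open>c\<^sub>0\<^sup>M p\<close> is a
  polynomial \<open>G\<close> in the coefficients of \<open>a, b, c\<close>, which are multiples of the derivatives of the
  generators. Exchanging the roles of \<open>X\<close> and \<open>Y\<close> shows that all jets with \<open>c\<^sub>0 = 0\<close>,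
  \<open>a\<^sub>0 \<noteq> 0\<close> arise from pairs; as \<open>G\<close> vanishes there, it is divisible by \<open>c\<^sub>0\<close>, and the
  denominator can be cleared. For an element of \<open>P\<^sub>0\<close>, setting all variables of positive level
  to zero kills the proper derivatives of the generators.\<close>

section \<open>Evaluation of polynomials\<close>

definition mono_eval :: "('v \<Rightarrow> complex) \<Rightarrow> ('v \<Rightarrow>\<^sub>0 nat) \<Rightarrow> complex"
  where "mono_eval \<sigma> m = (\<Prod>v\<in>Poly_Mapping.keys m. \<sigma> v ^ Poly_Mapping.lookup m v)"

definition peval :: "('v \<Rightarrow> complex) \<Rightarrow> 'v cpoly \<Rightarrow> complex"
  where "peval \<sigma> p = (\<Sum>m\<in>Poly_Mapping.keys p. Poly_Mapping.lookup p m * mono_eval \<sigma> m)"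

lemma mono_eval_superset:
  assumes "finite A" "Poly_Mapping.keys m \<subseteq> A"
  shows "mono_eval \<sigma> m = (\<Prod>v\<in>A. \<sigma> v ^ Poly_Mapping.lookup m v)"
  unfolding mono_eval_def using assms
  by (intro prod.mono_neutral_left) (auto simp: in_keys_iff)

lemma peval_superset:
  assumes "finite A" "Poly_Mapping.keys p \<subseteq> A"
  shows "peval \<sigma> p = (\<Sum>m\<in>A. Poly_Mapping.lookup p m * mono_eval \<sigma> m)"
  unfolding peval_def using assms
  by (intro sum.mono_neutral_left) (auto simp: in_keys_iff)

lemma mono_eval_add: "mono_eval \<sigma> (m + n) = mono_eval \<sigma> m * mono_eval \<sigma> n"
proof -
  let ?A = "Poly_Mapping.keys m \<union> Poly_Mapping.keys n"
  show ?thesis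
    using keys_add[of m n]
    by (simp add: mono_eval_superset[where A = ?A] lookup_add power_add prod.distrib)
qed

lemma peval_add [simp]: "peval \<sigma> (p + q) = peval \<sigma> p + peval \<sigma> q"
proof -
  let ?A = "Poly_Mapping.keys p \<union> Poly_Mapping.keys q"
  show ?thesis
    using keys_add[of p q]
    by (simp add: peval_superset[where A = ?A] lookup_add distrib_right sum.distrib)
qed

lemma peval_single: "peval \<sigma> (Poly_Mapping.single m c) = c * mono_eval \<sigma> m"
  by (simp add: peval_superset[where A = "{m}"])

lemma peval_Const [simp]: "peval \<sigma> (Const c) = c"
  by (simp add: Const_def peval_single mono_eval_def)

lemma peval_0 [simp]: "peval \<sigma> 0 = 0"
  by (simp add: peval_def)

lemma peval_1 [simp]: "peval \<sigma> 1 = 1"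
  using peval_Const[of \<sigma> 1] by simp

lemma peval_Var [simp]: "peval \<sigma> (Var v) = \<sigma> v"
  by (simp add: Var_def peval_single mono_eval_def)

lemma peval_mult [simp]: "peval \<sigma> (p * q) = peval \<sigma> p * peval \<sigma> q"
proof (induction p rule: cpoly_additive_induct)
  case (single m c)
  show ?case
    by (induction q rule: cpoly_additive_induct)
      (simp_all add: mult_single peval_single mono_eval_add algebra_simps)
qed (simp add: algebra_simps)

lemma peval_uminus [simp]: "peval \<sigma> (- p) = - peval \<sigma> p"
  using peval_add[of \<sigma> p "- p"] by (simp add: add_eq_0_iff del: peval_add)

lemma peval_diff [simp]: "peval \<sigma> (p - q) = peval \<sigma> p - peval \<sigma> q"
  using peval_add[of \<sigma> p "- q"] by simp

lemma peval_power [simp]: "peval \<sigma> (p ^ n) = peval \<sigma> p ^ n"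
  by (induction n) simp_all

lemma peval_sum [simp]: "peval \<sigma> (sum f A) = (\<Sum>i\<in>A. peval \<sigma> (f i))"
  by (induction A rule: infinite_finite_induct) simp_all

text \<open>Chain rule along a curve with velocity \<open>\<phi>\<close>: both sides obey the
  Leibniz rule, so the variables decide.\<close>

lemma peval_has_field_derivative:
  assumes "\<And>v. ((\<lambda>z. \<sigma> z v) has_field_derivative peval (\<sigma> z) (\<phi> v)) (at z)"
  shows "((\<lambda>z. peval (\<sigma> z) p) has_field_derivative peval (\<sigma> z) (var_der \<phi> p)) (at z)"
proof (induction p rule: cpoly_induct)
  case (add p q)
  then show ?case by (auto intro!: derivative_eq_intros simp: var_der_add)
next
  case (mult p q)
  then show ?case by (auto intro!: derivative_eq_intros simp: var_der_mult)
qed (simp_all add: assms)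

lemma lookup_partial_derivative:
  "Poly_Mapping.lookup (var_der (\<lambda>w. if w = v then 1 else 0) p) m =
    of_nat (Suc (Poly_Mapping.lookup m v)) * Poly_Mapping.lookup p (m + Poly_Mapping.single v 1)"
proof (induction p rule: cpoly_additive_induct)
  case (single n c)
  have "monom_der (\<lambda>w. if w = v then 1 else 0) n =
      Poly_Mapping.single (n - Poly_Mapping.single v 1) (of_nat (Poly_Mapping.lookup n v))"
    by (subst monom_der_superset[where X = "insert v (Poly_Mapping.keys n)"])
      (simp_all add: mult_delta_right subset_insertI del: sum.insert sum.insert_if)
  then have 1: "var_der (\<lambda>w. if w = v then 1 else 0) (Poly_Mapping.single n c) =
      Poly_Mapping.single (n - Poly_Mapping.single v 1) (c * of_nat (Poly_Mapping.lookup n v))"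
    by (simp add: var_der_single Const_def mult_single)
  show ?case
  proof (cases "n = m + Poly_Mapping.single v 1")
    case True
    then show ?thesis unfolding 1 by (simp add: lookup_add lookup_single)
  next
    case False
    have "Poly_Mapping.lookup n v = 0 \<or> n - Poly_Mapping.single v 1 \<noteq> m"
    proof (rule ccontr)
      assume "\<not> ?thesis"
      then have "n = m + Poly_Mapping.single v 1"
        by (intro poly_mapping_eqI)
          (auto simp: lookup_add lookup_minus lookup_single when_def)
      with False show False by simp
    qed
    then show ?thesis unfolding 1 using False by (auto simp: lookup_single when_def)
  qed
qed (simp add: var_der_add lookup_add algebra_simps)

text \<open>Each coefficient is, up to a nonzero factor, the constant term of an iterated partial
  derivative, and partial derivatives of a vanishing function vanish. Only one coordinate varies at
  a time, so infinitely many variables do no harm.\<close>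

lemma peval_eq_0_imp_eq_0:
  assumes "\<And>\<sigma>. peval \<sigma> p = 0"
  shows "p = 0"
proof -
  have "(\<forall>\<sigma>. peval \<sigma> p = 0) \<Longrightarrow> Poly_Mapping.lookup p m = 0"
    if "sum (Poly_Mapping.lookup m) (Poly_Mapping.keys m) = n" for p :: "'a cpoly" and m n
    using that
  proof (induction n arbitrary: p m)
    case 0
    then have m: "m = 0"
      by (intro poly_mapping_eqI) (auto simp: in_keys_iff)
    have "mono_eval (\<lambda>_. 0) k = (if k = 0 then 1 else 0)" for k :: "'a \<Rightarrow>\<^sub>0 nat"
      by (auto simp: mono_eval_def in_keys_iff power_0_left)
    then have "peval (\<lambda>_. 0) p = Poly_Mapping.lookup p 0"
      by (subst peval_superset[where A = "insert 0 (Poly_Mapping.keys p)"])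
        (simp_all add: mult_delta_right subset_insertI del: sum.insert sum.insert_if)
    with 0 m show ?case by simp
  next
    case (Suc n)
    then obtain v where v: "v \<in> Poly_Mapping.keys m"
      by (metis all_not_in_conv nat.distinct(1) sum.empty)
    define m' where "m' = m - Poly_Mapping.single v 1"
    have m: "m = m' + Poly_Mapping.single v 1"
      unfolding m'_def using v
      by (intro poly_mapping_eqI)
        (auto simp: lookup_add lookup_minus lookup_single when_def in_keys_iff)
    have fin: "finite (Poly_Mapping.keys m)" by simp
    have "sum (Poly_Mapping.lookup m') (Poly_Mapping.keys m') =
        sum (Poly_Mapping.lookup m') (Poly_Mapping.keys m)"
      by (intro sum.mono_neutral_left) (auto simp: m lookup_add in_keys_iff)
    moreover have "sum (Poly_Mapping.lookup m) (Poly_Mapping.keys m) =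
        sum (Poly_Mapping.lookup m') (Poly_Mapping.keys m) + 1"
    proof -
      have "Poly_Mapping.lookup m w = Poly_Mapping.lookup m' w + (if w = v then 1 else 0)" for w
        by (auto simp: m lookup_add lookup_single)
      then show ?thesis using v fin by (simp add: sum.distrib)
    qed
    ultimately have n: "sum (Poly_Mapping.lookup m') (Poly_Mapping.keys m') = n"
      using Suc.prems(2) by simp
    let ?D = "var_der (\<lambda>w. if w = v then 1 else 0)"
    have "peval \<sigma> (?D p) = 0" for \<sigma>
    proof -
      have "((\<lambda>z. peval (\<sigma>(v := z)) p) has_field_derivative
          peval (\<sigma>(v := \<sigma> v)) (?D p)) (at (\<sigma> v))"
        by (rule peval_has_field_derivative) (auto intro!: derivative_eq_intros)
      moreover have "((\<lambda>z. peval (\<sigma>(v := z)) p) has_field_derivative 0) (at (\<sigma> v))"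
        using Suc.prems(1) by simp
      ultimately show ?thesis using DERIV_unique by fastforce
    qed
    then have "Poly_Mapping.lookup (?D p) m' = 0" using Suc.IH n by blast
    then show ?case
      unfolding lookup_partial_derivative m by (simp del: of_nat_Suc)
  qed
  then show ?thesis using assms by (intro poly_mapping_eqI) auto
qed

section \<open>Restriction to lines and density of nonvanishing loci\<close>

lemma peval_line:
  "\<exists>u. \<forall>z. peval (\<lambda>v. \<sigma> v + z * \<tau> v) p = poly u z"
proof (induction p rule: cpoly_induct)
  case (add p q)
  then obtain u w where "\<forall>z. peval (\<lambda>v. \<sigma> v + z * \<tau> v) p = poly u z"
    "\<forall>z. peval (\<lambda>v. \<sigma> v + z * \<tau> v) q = poly w z" by blast
  then show ?case by (intro exI[of _ "u + w"]) simp
next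
  case (Const c)
  show ?case by (intro exI[of _ "[:c:]"]) simp
next
  case (Var v)
  show ?case by (intro exI[of _ "[:\<sigma> v, \<tau> v:]"]) simp
next
  case (mult p q)
  then obtain u w where "\<forall>z. peval (\<lambda>v. \<sigma> v + z * \<tau> v) p = poly u z"
    "\<forall>z. peval (\<lambda>v. \<sigma> v + z * \<tau> v) q = poly w z" by blast
  then show ?case by (intro exI[of _ "u * w"]) simp
qed

text \<open>On the line from \<open>\<sigma>0\<close> to \<open>\<sigma>\<close> the product of the
  two restrictions is the zero polynomial while that of \<open>q\<close> is not, so \<open>p\<close>
  vanishes on the whole line.\<close>

lemma peval_cancel:
  assumes "\<And>\<sigma>. peval \<sigma> q \<noteq> 0 \<Longrightarrow> peval \<sigma> p = 0" and "peval \<sigma>0 q \<noteq> 0"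
  shows "peval \<sigma> p = 0"
proof -
  let ?l = "\<lambda>z v. \<sigma>0 v + z * (\<sigma> v - \<sigma>0 v)"
  obtain u w where u: "\<And>z. peval (?l z) p = poly u z" and w: "\<And>z. peval (?l z) q = poly w z"
    using peval_line[of \<sigma>0 "\<lambda>v. \<sigma> v - \<sigma>0 v"] by metis
  have "poly w 0 \<noteq> 0" using w[of 0] assms(2) by simp
  moreover have "poly (u * w) z = 0" for z
    using assms(1)[of "?l z"] by (auto simp: u w)
  then have "u * w = 0" using poly_all_0_iff_0 by blast
  ultimately have "u = 0" by auto
  then show ?thesis using u[of 1] by simp
qed

section \<open>Subalgebras and substitution\<close>

lemma subalgebra_hull: "subalgebra (subalgebra hull S)"
  by (rule hull_in) (fastforce simp: subalgebra_def)

lemma subalgebra_hull_closed: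
  shows "Const c \<in> subalgebra hull S"
    and "p \<in> subalgebra hull S \<Longrightarrow> q \<in> subalgebra hull S \<Longrightarrow> p + q \<in> subalgebra hull S"
    and "p \<in> subalgebra hull S \<Longrightarrow> q \<in> subalgebra hull S \<Longrightarrow> p * q \<in> subalgebra hull S"
  using subalgebra_hull[of S] by (auto simp: subalgebra_def)

lemma peval_substitution:
  assumes "\<And>j. W j \<in> subalgebra hull S"
  shows "\<exists>q\<in>subalgebra hull S. \<forall>\<sigma>. peval \<sigma> q = peval (\<lambda>j. peval \<sigma> (W j)) G"
proof (induction G rule: cpoly_induct)
  case (add p q)
  then show ?case by (metis subalgebra_hull_closed(2) peval_add)
next
  case (Const c)
  show ?case by (intro bexI[of _ "Const c"]) (auto simp: subalgebra_hull_closed)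
next
  case (Var v)
  show ?case by (intro bexI[of _ "W v"]) (auto simp: assms)
next
  case (mult p q)
  then show ?case by (metis subalgebra_hull_closed(3) peval_mult)
qed

lemma cpoly_eqI:
  assumes "\<And>\<sigma>. peval \<sigma> p = peval \<sigma> q"
  shows "p = q"
  using peval_eq_0_imp_eq_0[of "p - q"] assms by simp

section \<open>Splitting off one variable\<close>

lemma peval_set_variable_0: "\<exists>G0. \<forall>\<tau>. peval \<tau> G0 = peval (\<tau>(v := 0)) G"
proof (induction G rule: cpoly_induct)
  case (add p q)
  then obtain p0 q0 where "\<forall>\<tau>. peval \<tau> p0 = peval (\<tau>(v := 0)) p"
    "\<forall>\<tau>. peval \<tau> q0 = peval (\<tau>(v := 0)) q" by blast
  then show ?case by (intro exI[of _ "p0 + q0"]) (simp del: fun_upd_apply)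
next
  case (Const c)
  show ?case by (intro exI[of _ "Const c"]) simp
next
  case (Var w)
  show ?case by (intro exI[of _ "if v = w then 0 else Var w"]) simp
next
  case (mult p q)
  then obtain p0 q0 where "\<forall>\<tau>. peval \<tau> p0 = peval (\<tau>(v := 0)) p"
    "\<forall>\<tau>. peval \<tau> q0 = peval (\<tau>(v := 0)) q" by blast
  then show ?case by (intro exI[of _ "p0 * q0"]) (simp del: fun_upd_apply)
qed

text \<open>Factor theorem in \<open>v\<close>; for products it follows from
  \<open>p q - p0 q0 = (p - p0) q + p0 (q - q0)\<close>.\<close>

lemma peval_split_variable:
  "\<exists>G'. \<forall>\<tau>. peval \<tau> G - peval (\<tau>(v := 0)) G = \<tau> v * peval \<tau> G'"
proof (induction G rule: cpoly_induct)
  case (add p q)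
  then obtain p' q' where *: "\<forall>\<tau>. peval \<tau> p - peval (\<tau>(v := 0)) p = \<tau> v * peval \<tau> p'"
    "\<forall>\<tau>. peval \<tau> q - peval (\<tau>(v := 0)) q = \<tau> v * peval \<tau> q'" by blast
  show ?case
    by (intro exI[of _ "p' + q'"]) (simp add: distrib_left add_diff_add flip: * del: fun_upd_apply)
next
  case (Const c)
  show ?case by (intro exI[of _ 0]) simp
next
  case (Var w)
  show ?case by (intro exI[of _ "if v = w then 1 else 0"]) simp
next
  case (mult p q)
  then obtain p' q' where *: "\<And>\<tau>. peval \<tau> p - peval (\<tau>(v := 0)) p = \<tau> v * peval \<tau> p'"
    "\<And>\<tau>. peval \<tau> q - peval (\<tau>(v := 0)) q = \<tau> v * peval \<tau> q'" by blast
  obtain p0 where p0: "\<And>\<tau>. peval \<tau> p0 = peval (\<tau>(v := 0)) p"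
    using peval_set_variable_0[of v p] by blast
  have "peval \<tau> (p * q) - peval (\<tau>(v := 0)) (p * q) = \<tau> v * peval \<tau> (p' * q + p0 * q')" for \<tau>
  proof -
    have "peval \<tau> (p * q) - peval (\<tau>(v := 0)) (p * q) =
        (peval \<tau> p - peval (\<tau>(v := 0)) p) * peval \<tau> q +
        peval (\<tau>(v := 0)) p * (peval \<tau> q - peval (\<tau>(v := 0)) q)"
      by (simp add: algebra_simps)
    then show ?thesis by (simp only: *) (simp add: p0 algebra_simps)
  qed
  then show ?case by blast
qed

unbundle no vec_syntax
unbundle fps_syntax

section \<open>Invariance under arcs in \<open>SL\<^sub>2\<close>\<close>

text \<open>\<open>X\<close> and \<open>Y\<close> are arcs of traceless matrices. The \<open>\<gamma>\<close>-variables are the entries of \<open>X\<close>; the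
  \<open>\<beta>\<close>-variables are those of \<open>Y\<close> after the identification of \<open>V\<close> with \<open>V\<^sup>*\<close> through the
  invariant form, which exchanges \<open>e\<close> and \<open>f\<close>. Since \<open>\<beta>\<^sub>k\<close> stands for a \<open>k\<close>-th derivative, a
  factor \<open>k!\<close> appears.\<close>

fun pt :: "(idx \<Rightarrow> complex fps) \<Rightarrow> (idx \<Rightarrow> complex fps) \<Rightarrow> var \<Rightarrow> complex" where
  "pt X Y (Gamma k b) = fact k * X b $ k"
| "pt X Y (Beta k Ei) = fact k * Y Fi $ k / 2"
| "pt X Y (Beta k Fi) = fact k * Y Ei $ k / 2"
| "pt X Y (Beta k Hi) = fact k * Y Hi $ k"

lemma pt_surj: "\<exists>X Y. \<sigma> = pt X Y"
proof (intro exI ext)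
  fix v
  show "\<sigma> v = pt (\<lambda>b. Abs_fps (\<lambda>k. \<sigma> (Gamma k b) / fact k))
    (\<lambda>b. Abs_fps (\<lambda>k. case b of Ei \<Rightarrow> 2 * \<sigma> (Beta k Fi) / fact k
      | Fi \<Rightarrow> 2 * \<sigma> (Beta k Ei) / fact k | Hi \<Rightarrow> \<sigma> (Beta k Hi) / fact k)) v"
  proof (cases v)
    case (Beta k b)
    then show ?thesis by (cases b) simp_all
  qed simp
qed

text \<open>The derivation given by \<open>u \<otimes> \<alpha>(t)\<close> for a power series \<open>\<alpha>\<close>.\<close>

fun arc_var :: "complex^2^2 \<Rightarrow> complex fps \<Rightarrow> var \<Rightarrow> var cpoly" where
  "arc_var u \<alpha> (Beta k b) = (\<Sum>n\<le>k. Const (\<alpha> $ n) * act_var u n (Beta k b))"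
| "arc_var u \<alpha> (Gamma k b) = (\<Sum>n\<le>k. Const (\<alpha> $ n) * act_var u n (Gamma k b))"

lemma act_add: "act u n (p + q) = act u n p + act u n q"
  by (simp add: act_def var_der_add)

lemma act_mult: "act u n (p * q) = act u n p * q + p * act u n q"
  by (simp add: act_def var_der_mult)

lemma act_Const [simp]: "act u n (Const c) = 0"
  by (simp add: act_def)

text \<open>The derivation \<open>u \<otimes> t^n\<close> kills every variable of level below
  \<open>n\<close>, so each polynomial sees only finitely many terms of
  \<open>\<alpha>\<close>.\<close>

lemma arc_var_eq_sum:
  "\<exists>N. \<forall>M\<ge>N. var_der (arc_var u \<alpha>) p = (\<Sum>n<M. Const (\<alpha> $ n) * act u n p)"
proof (induction p rule: cpoly_induct)
  case (add p q)
  then obtain N1 N2 where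
    N1: "\<And>M. N1 \<le> M \<Longrightarrow> var_der (arc_var u \<alpha>) p = (\<Sum>n<M. Const (\<alpha> $ n) * act u n p)" and
    N2: "\<And>M. N2 \<le> M \<Longrightarrow> var_der (arc_var u \<alpha>) q = (\<Sum>n<M. Const (\<alpha> $ n) * act u n q)"
    by blast
  have "var_der (arc_var u \<alpha>) (p + q) = (\<Sum>n<M. Const (\<alpha> $ n) * act u n (p + q))"
    if "max N1 N2 \<le> M" for M
    using N1[of M] N2[of M] that by (simp add: var_der_add act_add distrib_left sum.distrib)
  then show ?case by blast
next
  case (Const c)
  show ?case by simp
next
  case (Var v)
  have "\<exists>k. arc_var u \<alpha> v = (\<Sum>n\<le>k. Const (\<alpha> $ n) * act_var u n v) \<and> (\<forall>n>k. act_var u n v = 0)"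
  proof (cases v)
    case (Beta k b)
    then show ?thesis by (intro exI[of _ k]) (simp add: Ccoeff_def del: of_nat_prod)
  next
    case (Gamma k b)
    then show ?thesis by (intro exI[of _ k]) (simp add: Ccoeff_def del: of_nat_prod)
  qed
  then obtain k where k: "arc_var u \<alpha> v = (\<Sum>n\<le>k. Const (\<alpha> $ n) * act_var u n v)"
    "\<forall>n>k. act_var u n v = 0" by blast
  have "arc_var u \<alpha> v = (\<Sum>n<M. Const (\<alpha> $ n) * act_var u n v)" if "Suc k \<le> M" for M
    unfolding k(1) using that k(2)
    by (intro sum.mono_neutral_left) auto
  then show ?case unfolding act_def by auto
next
  case (mult p q)
  then obtain N1 N2 where
    N1: "\<And>M. N1 \<le> M \<Longrightarrow> var_der (arc_var u \<alpha>) p = (\<Sum>n<M. Const (\<alpha> $ n) * act u n p)" and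
    N2: "\<And>M. N2 \<le> M \<Longrightarrow> var_der (arc_var u \<alpha>) q = (\<Sum>n<M. Const (\<alpha> $ n) * act u n q)"
    by blast
  have "var_der (arc_var u \<alpha>) (p * q) = (\<Sum>n<M. Const (\<alpha> $ n) * act u n (p * q))"
    if "max N1 N2 \<le> M" for M
    using N1[of M] N2[of M] that
    by (simp add: var_der_mult act_mult distrib_left sum.distrib sum_distrib_left
        sum_distrib_right mult_ac)
  then show ?case by blast
qed

lemma arc_var_invariant:
  assumes "\<And>n. act u n p = 0"
  shows "var_der (arc_var u \<alpha>) p = 0"
  using arc_var_eq_sum[of u \<alpha> p] assms by auto

text \<open>The coefficient is \<open>k! / (k - n)!\<close>, so the factorials in \<open>pt\<close>
  turn the action of \<open>t^n\<close> into multiplication of power series by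
  \<open>t^n\<close>.\<close>

lemma Ccoeff_fact: "n \<le> k \<Longrightarrow> Ccoeff k n * fact (k - n) = fact k"
proof (induction n)
  case (Suc n)
  have "fact (k - n) = (of_nat (k - n) * fact (k - Suc n) :: complex)"
    using Suc.prems by (metis Suc_diff_Suc Suc_le_lessD fact_Suc of_nat_mult of_nat_fact)
  with Suc show ?case by (simp add: Ccoeff_def mult_ac)
qed (simp add: Ccoeff_def)

lemma sum_Ccoeff_fact:
  "(\<Sum>n\<le>k. \<alpha> $ n * (Ccoeff k n * (fact (k - n) * F $ (k - n)))) = fact k * (\<alpha> * F) $ k"
proof -
  have "\<alpha> $ n * (Ccoeff k n * (fact (k - n) * F $ (k - n))) = fact k * (\<alpha> $ n * F $ (k - n))"
    if "n \<le> k" for n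
    using Ccoeff_fact[OF that] by (metis mult.assoc mult.commute mult.left_commute)
  then show ?thesis
    unfolding fps_mult_nth atLeast0AtMost sum_distrib_left by (intro sum.cong) simp_all
qed

text \<open>Conjugation of \<open>X\<close> by the unipotent matrix \<open>1 + s e\<close>;
  \<open>moveF\<close> uses \<open>1 + s f\<close>.\<close>

definition moveE :: "complex fps \<Rightarrow> (idx \<Rightarrow> complex fps) \<Rightarrow> idx \<Rightarrow> complex fps"
  where "moveE s X b = (case b of Ei \<Rightarrow> X Ei - 2 * s * X Hi - s\<^sup>2 * X Fi
    | Fi \<Rightarrow> X Fi | Hi \<Rightarrow> X Hi + s * X Fi)"

definition moveF :: "complex fps \<Rightarrow> (idx \<Rightarrow> complex fps) \<Rightarrow> idx \<Rightarrow> complex fps"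
  where "moveF s X b = (case b of Ei \<Rightarrow> X Ei
    | Fi \<Rightarrow> X Fi + 2 * s * X Hi - s\<^sup>2 * X Ei | Hi \<Rightarrow> X Hi - s * X Ei)"

text \<open>This is \<open>-[e, X]\<close>, and \<open>lieF\<close> is \<open>-[f, X]\<close>:
  derivations act contragrediently on coordinate functions. Hence the choice
  \<open>\<alpha> = - s\<close> for the flows.\<close>

definition lieE :: "(idx \<Rightarrow> complex fps) \<Rightarrow> idx \<Rightarrow> complex fps"
  where "lieE X b = (case b of Ei \<Rightarrow> 2 * X Hi | Fi \<Rightarrow> 0 | Hi \<Rightarrow> - X Fi)"

definition lieF :: "(idx \<Rightarrow> complex fps) \<Rightarrow> idx \<Rightarrow> complex fps"
  where "lieF X b = (case b of Ei \<Rightarrow> 0 | Fi \<Rightarrow> - 2 * X Hi | Hi \<Rightarrow> X Ei)"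

lemma sum_Ccoeff_pt:
  "(\<Sum>n\<le>k. \<alpha> $ n * (Ccoeff k n * pt X Y (Beta (k - n) b))) =
    pt (\<lambda>c. \<alpha> * X c) (\<lambda>c. \<alpha> * Y c) (Beta k b)"
  "(\<Sum>n\<le>k. \<alpha> $ n * (Ccoeff k n * pt X Y (Gamma (k - n) b))) =
    pt (\<lambda>c. \<alpha> * X c) (\<lambda>c. \<alpha> * Y c) (Gamma k b)"
  by (cases b) (simp_all add: sum_Ccoeff_fact flip: sum_divide_distrib)

lemma peval_arc_E:
  "peval (pt X Y) (arc_var (basis Ei) \<alpha> v) = pt (\<lambda>b. \<alpha> * lieE X b) (\<lambda>b. \<alpha> * lieE Y b) v"
proof -
  have "peval (pt X Y) (beta j (bracket (basis Ei) (basis b))) = pt (lieE X) (lieE Y) (Beta j b)"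
    "peval (pt X Y) (gamma j (coad (basis Ei) (dual_basis b))) = pt (lieE X) (lieE Y) (Gamma j b)"
    for j b
    by (cases b; simp add: beta_def gamma_def coad_def bracket_def matrix_matrix_mult_def sum_2
        lieE_def numeral_fps_const)+
  then show ?thesis
    by (cases v) (simp_all add: sum_Ccoeff_pt del: pt.simps basis.simps dual_basis.simps)
qed

lemma peval_arc_F:
  "peval (pt X Y) (arc_var (basis Fi) \<alpha> v) = pt (\<lambda>b. \<alpha> * lieF X b) (\<lambda>b. \<alpha> * lieF Y b) v"
proof -
  have "peval (pt X Y) (beta j (bracket (basis Fi) (basis b))) = pt (lieF X) (lieF Y) (Beta j b)"
    "peval (pt X Y) (gamma j (coad (basis Fi) (dual_basis b))) = pt (lieF X) (lieF Y) (Gamma j b)"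
    for j b
    by (cases b; simp add: beta_def gamma_def coad_def bracket_def matrix_matrix_mult_def sum_2
        lieF_def numeral_fps_const)+
  then show ?thesis
    by (cases v) (simp_all add: sum_Ccoeff_pt del: pt.simps basis.simps dual_basis.simps)
qed

lemma has_field_derivative_pt:
  assumes "\<And>b k. ((\<lambda>z. X z b $ k) has_field_derivative X' b $ k) (at z)"
    and "\<And>b k. ((\<lambda>z. Y z b $ k) has_field_derivative Y' b $ k) (at z)"
  shows "((\<lambda>z. pt (X z) (Y z) v) has_field_derivative pt X' Y' v) (at z)"
proof (cases v)
  case (Beta k b)
  then show ?thesis by (cases b) (auto intro!: derivative_eq_intros assms)
next
  case (Gamma k b)
  then show ?thesis by (auto intro!: derivative_eq_intros assms)
qed

section \<open>Integral curves of the nilpotent derivations\<close>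

lemma has_field_derivative_fps_quadratic:
  fixes A B C :: "complex fps"
  shows "((\<lambda>z. (A + fps_const z * B + (fps_const z)\<^sup>2 * C) $ k) has_field_derivative
    (B + 2 * fps_const z * C) $ k) (at z)"
proof -
  have "(A + fps_const z * B + (fps_const z)\<^sup>2 * C) $ k = A $ k + z * B $ k + z\<^sup>2 * C $ k" for z
    by (simp add: power2_eq_square mult.assoc)
  moreover have "(B + 2 * fps_const z * C) $ k = B $ k + 2 * z * C $ k"
    by (simp add: numeral_fps_const mult.assoc)
  ultimately show ?thesis by (auto intro!: derivative_eq_intros)
qed

lemma has_field_derivative_moveE:
  "((\<lambda>z. moveE (fps_const z * s) X b $ k) has_field_derivative
    (- s * lieE (moveE (fps_const z * s) X) b) $ k) (at z)"
proof (cases b)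
  case Ei
  have "moveE (fps_const z * s) X b =
      X Ei + fps_const z * (- 2 * s * X Hi) + (fps_const z)\<^sup>2 * (- s\<^sup>2 * X Fi)" for z
    unfolding moveE_def Ei by (simp add: power2_eq_square algebra_simps)
  moreover have "- s * lieE (moveE (fps_const z * s) X) b =
      - 2 * s * X Hi + 2 * fps_const z * (- s\<^sup>2 * X Fi)"
    unfolding moveE_def lieE_def Ei by (simp add: power2_eq_square algebra_simps)
  ultimately show ?thesis by (simp only: has_field_derivative_fps_quadratic)
next
  case Hi
  then show ?thesis
    using has_field_derivative_fps_quadratic[of "X Hi" "s * X Fi" 0 k z]
    by (simp add: moveE_def lieE_def mult.assoc)
qed (simp add: moveE_def lieE_def)

lemma has_field_derivative_moveF:
  "((\<lambda>z. moveF (fps_const z * s) X b $ k) has_field_derivative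
    (- s * lieF (moveF (fps_const z * s) X) b) $ k) (at z)"
proof (cases b)
  case Fi
  have "moveF (fps_const z * s) X b =
      X Fi + fps_const z * (2 * s * X Hi) + (fps_const z)\<^sup>2 * (- s\<^sup>2 * X Ei)" for z
    unfolding moveF_def Fi by (simp add: power2_eq_square algebra_simps)
  moreover have "- s * lieF (moveF (fps_const z * s) X) b =
      2 * s * X Hi + 2 * fps_const z * (- s\<^sup>2 * X Ei)"
    unfolding moveF_def lieF_def Fi by (simp add: power2_eq_square algebra_simps)
  ultimately show ?thesis by (simp only: has_field_derivative_fps_quadratic)
next
  case Hi
  then show ?thesis
    using has_field_derivative_fps_quadratic[of "X Hi" "- s * X Ei" 0 k z]
    by (simp add: moveF_def lieF_def mult.assoc)
qed (simp add: moveF_def lieF_def)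

lemma moveE_0 [simp]: "moveE 0 X = X"
  by (rule ext) (simp add: moveE_def split: idx.split)

lemma moveF_0 [simp]: "moveF 0 X = X"
  by (rule ext) (simp add: moveF_def split: idx.split)

text \<open>The derivative of \<open>p\<close> along an integral curve is the value of the
  derivation on \<open>p\<close>, which is zero.\<close>

lemma peval_constant_along_flow:
  assumes "\<And>n. act u n p = 0"
    and "\<And>z v. ((\<lambda>z. \<sigma> z v) has_field_derivative peval (\<sigma> z) (arc_var u \<alpha> v)) (at z)"
  shows "peval (\<sigma> 1) p = peval (\<sigma> 0) p"
proof -
  have "((\<lambda>z. peval (\<sigma> z) p) has_field_derivative 0) (at z)" for z
    using peval_has_field_derivative[OF assms(2)] arc_var_invariant[OF assms(1)] by (metis peval_0)
  then obtain c where "\<And>z. peval (\<sigma> z) p = c"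
    using has_field_derivative_zero_constant[of UNIV "\<lambda>z. peval (\<sigma> z) p"] by auto
  then show ?thesis by simp
qed

lemma peval_moveE:
  assumes "\<And>n. act (basis Ei) n p = 0"
  shows "peval (pt (moveE s X) (moveE s Y)) p = peval (pt X Y) p"
  using peval_constant_along_flow[OF assms,
      where \<sigma> = "\<lambda>z. pt (moveE (fps_const z * s) X) (moveE (fps_const z * s) Y)" and \<alpha> = "- s"]
  by (simp add: peval_arc_E has_field_derivative_pt has_field_derivative_moveE
      del: mult_minus_left basis.simps)

lemma peval_moveF:
  assumes "\<And>n. act (basis Fi) n p = 0"
  shows "peval (pt (moveF s X) (moveF s Y)) p = peval (pt X Y) p"
  using peval_constant_along_flow[OF assms,
      where \<sigma> = "\<lambda>z. pt (moveF (fps_const z * s) X) (moveF (fps_const z * s) Y)" and \<alpha> = "- s"]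
  by (simp add: peval_arc_F has_field_derivative_pt has_field_derivative_moveF
      del: mult_minus_left basis.simps)

text \<open>For \<open>p s - q r = 1\<close> this is conjugation of \<open>X\<close> by the matrix
  with rows \<open>(p, q)\<close> and \<open>(r, s)\<close>.\<close>

definition conj_arc :: "complex fps \<Rightarrow> complex fps \<Rightarrow> complex fps \<Rightarrow> complex fps \<Rightarrow>
    (idx \<Rightarrow> complex fps) \<Rightarrow> idx \<Rightarrow> complex fps"
  where "conj_arc p q r s X b = (case b of
      Ei \<Rightarrow> p\<^sup>2 * X Ei - q\<^sup>2 * X Fi - 2 * p * q * X Hi
    | Fi \<Rightarrow> s\<^sup>2 * X Fi - r\<^sup>2 * X Ei + 2 * r * s * X Hi
    | Hi \<Rightarrow> (p * s + q * r) * X Hi + q * s * X Fi - p * r * X Ei)"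

text \<open>A matrix of determinant 1 with invertible lower left entry \<open>r\<close> is a product of three
  elementary matrices.\<close>

lemma conj_arc_eq_moves:
  assumes det: "p * s - q * r = 1" and r: "r $ 0 \<noteq> 0"
  shows "conj_arc p q r s X =
    moveE ((p - 1) * inverse r) (moveF r (moveE ((s - 1) * inverse r) X))"
proof -
  define \<alpha> where "\<alpha> = (p - 1) * inverse r"
  define \<beta> where "\<beta> = (s - 1) * inverse r"
  have inv: "inverse r * r = 1" using r by (rule inverse_mult_eq_1)
  have p: "p = 1 + \<alpha> * r" and s: "s = 1 + r * \<beta>"
    unfolding \<alpha>_def \<beta>_def using inv by (simp_all add: algebra_simps)
  have "q * r = (\<alpha> + \<beta> + \<alpha> * r * \<beta>) * r"
    using det unfolding p s by (simp add: algebra_simps)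
  then have q: "q = \<alpha> + \<beta> + \<alpha> * r * \<beta>" using r by auto
  show ?thesis
    unfolding \<alpha>_def[symmetric] \<beta>_def[symmetric] unfolding p q s
    by (intro ext) (auto simp: conj_arc_def moveE_def moveF_def power2_eq_square algebra_simps
        split: idx.split)
qed

lemma peval_conj_arc:
  assumes "\<And>n. act (basis Ei) n P = 0" "\<And>n. act (basis Fi) n P = 0"
    and "p * s - q * r = 1" "r $ 0 \<noteq> 0"
  shows "peval (pt (conj_arc p q r s X) (conj_arc p q r s Y)) P = peval (pt X Y) P"
  unfolding conj_arc_eq_moves[OF assms(3,4)]
  by (simp only: peval_moveE[OF assms(1)] peval_moveF[OF assms(2)])

section \<open>Jets of the generators\<close>

text \<open>Minus the determinant, so that \<open>X^2\<close> is the scalar \<open>quad X\<close>.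
  Its polarization \<open>polar X Y\<close> is the trace of \<open>X Y\<close>.\<close>

definition quad :: "(idx \<Rightarrow> complex fps) \<Rightarrow> complex fps"
  where "quad X = (X Hi)\<^sup>2 + X Ei * X Fi"

definition polar :: "(idx \<Rightarrow> complex fps) \<Rightarrow> (idx \<Rightarrow> complex fps) \<Rightarrow> complex fps"
  where "polar X Y = 2 * X Hi * Y Hi + X Ei * Y Fi + X Fi * Y Ei"

definition triple :: "'a \<Rightarrow> 'a \<Rightarrow> 'a \<Rightarrow> idx \<Rightarrow> 'a"
  where "triple x y z b = (case b of Ei \<Rightarrow> x | Fi \<Rightarrow> y | Hi \<Rightarrow> z)"

lemma triple_simps [simp]: "triple x y z Ei = x" "triple x y z Fi = y" "triple x y z Hi = z"
  by (simp_all add: triple_def)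

text \<open>The indices follow the names of the generators: \<open>Ei\<close> belongs to
  \<open>v_e\<close> and \<open>quad X\<close>, \<open>Fi\<close> to \<open>v_f\<close> and
  \<open>quad Y\<close>, \<open>Hi\<close> to \<open>v_h\<close> and
  \<open>polar X Y\<close>.\<close>

definition gram :: "(idx \<Rightarrow> complex fps) \<Rightarrow> (idx \<Rightarrow> complex fps) \<Rightarrow> idx \<times> nat \<Rightarrow> complex"
  where "gram X Y = (\<lambda>(b, k). triple (quad X) (quad Y) (polar X Y) b $ k)"

lemma gram_simps [simp]:
  "gram X Y (Ei, k) = quad X $ k" "gram X Y (Fi, k) = quad Y $ k" "gram X Y (Hi, k) = polar X Y $ k"
  by (simp_all add: gram_def)

lemma del_add: "del (p + q) = del p + del q"
  by (simp add: del_def var_der_add)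

lemma del_mult: "del (p * q) = del p * q + p * del q"
  by (simp add: del_def var_der_mult)

lemma del_Const [simp]: "del (Const c) = 0"
  by (simp add: del_def)

lemma del_funpow_add: "(del ^^ k) (p + q) = (del ^^ k) p + (del ^^ k) q"
  by (induction k) (simp_all add: del_add)

lemma del_funpow_Const_mult: "(del ^^ k) (Const c * p) = Const c * (del ^^ k) p"
  by (induction k) (simp_all add: del_mult)

lemma del_funpow_Var:
  "(del ^^ k) (Var (Beta j b)) = Var (Beta (k + j) b)"
  "(del ^^ k) (Var (Gamma j b)) = Var (Gamma (k + j) b)"
  by (induction k) (simp_all add: del_def)

text \<open>A ring homomorphism to power series turning \<open>del\<close> into the formal
  derivative; it computes all derivatives of a generator at once.\<close>

definition taylor :: "(var \<Rightarrow> complex) \<Rightarrow> var cpoly \<Rightarrow> complex fps"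
  where "taylor \<sigma> p = Abs_fps (\<lambda>k. peval \<sigma> ((del ^^ k) p) / fact k)"

lemma taylor_add: "taylor \<sigma> (p + q) = taylor \<sigma> p + taylor \<sigma> q"
  by (simp add: taylor_def fps_eq_iff del_funpow_add add_divide_distrib)

lemma taylor_Const: "taylor \<sigma> (Const c) = fps_const c"
proof -
  have "(del ^^ k) (Const c) = (if k = 0 then Const c else 0)" for k
    using del_Const[of 0] by (induction k) auto
  then show ?thesis by (simp add: taylor_def fps_eq_iff)
qed

lemma fps_deriv_taylor: "fps_deriv (taylor \<sigma> p) = taylor \<sigma> (del p)"
  by (simp add: taylor_def fps_eq_iff funpow_swap1 del: of_nat_Suc)

text \<open>Both sides satisfy the Leibniz rule, so their coefficients agree inductively.\<close>

lemma taylor_mult: "taylor \<sigma> (p * q) = taylor \<sigma> p * taylor \<sigma> q"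
proof -
  have "taylor \<sigma> (p * q) $ n = (taylor \<sigma> p * taylor \<sigma> q) $ n" for n
  proof (induction n arbitrary: p q)
    case 0
    show ?case by (simp add: taylor_def)
  next
    case (Suc n)
    have "of_nat (Suc n) * taylor \<sigma> (p * q) $ Suc n = fps_deriv (taylor \<sigma> (p * q)) $ n"
      by simp
    also have "\<dots> = taylor \<sigma> (del p * q) $ n + taylor \<sigma> (p * del q) $ n"
      by (simp only: fps_deriv_taylor del_mult taylor_add fps_add_nth)
    also have "\<dots> = fps_deriv (taylor \<sigma> p * taylor \<sigma> q) $ n"
      by (simp only: Suc.IH fps_deriv_mult fps_deriv_taylor fps_add_nth add.commute)
    also have "\<dots> = of_nat (Suc n) * (taylor \<sigma> p * taylor \<sigma> q) $ Suc n"
      by (simp only: fps_deriv_nth Suc_eq_plus1)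
    finally show ?case by (simp del: of_nat_Suc)
  qed
  then show ?thesis by (simp add: fps_eq_iff)
qed

lemma taylor_Var:
  "taylor (pt X Y) (Var (Gamma 0 b)) = X b"
  "taylor (pt X Y) (Var (Beta 0 b)) =
    triple (fps_const (1/2) * Y Fi) (fps_const (1/2) * Y Ei) (Y Hi) b"
  by (cases b; simp add: taylor_def fps_eq_iff del_funpow_Var)+

text \<open>The scalars are chosen to make the Taylor series at \<open>pt X Y\<close> equal to \<open>quad X\<close>, \<open>quad Y\<close>
  and \<open>polar X Y\<close>.\<close>

definition gen :: "idx \<Rightarrow> var cpoly"
  where "gen = triple (Const (1/4) * v_e) (Const (- 16) * v_f) (Const 2 * v_h)"

lemma taylor_gen: "taylor (pt X Y) (gen b) = triple (quad X) (quad Y) (polar X Y) b"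
proof -
  have cancel: "fps_const c * (fps_const d * F) = F" if "c * d = 1" for c d and F :: "complex fps"
    using that by (simp add: fps_eq_iff flip: mult.assoc)
  have half: "fps_const 2 * (fps_const (1/2) * F * G) = F * G" for F G :: "complex fps"
    by (simp add: fps_eq_iff mult.assoc)
  have quarter: "fps_const 4 * (fps_const (1/2) * F * (fps_const (1/2) * G)) = F * G"
    for F G :: "complex fps"
  proof -
    have "fps_const 4 * (fps_const (1/2) * (fps_const (1/2) * H)) = H" for H :: "complex fps"
      by (simp add: fps_eq_iff)
    from this[of "F * G"] show ?thesis by (simp only: mult_ac)
  qed
  show ?thesis
  proof (cases b)
    case Ei
    have "taylor (pt X Y) (gen b) =
        fps_const (1/4) * (fps_const 4 * (X Hi * X Hi + X Ei * X Fi))"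
      by (simp only: Ei gen_def triple_simps v_e_def gamma_dual_basis taylor_add taylor_mult
          taylor_Const taylor_Var)
    also have "\<dots> = quad X" by (subst cancel) (simp_all add: quad_def power2_eq_square)
    finally show ?thesis by (simp add: Ei)
  next
    case Fi
    have "taylor (pt X Y) (gen b) = fps_const (- 16) * (fps_const (- 1 / 16) *
        (Y Hi * Y Hi + fps_const 4 * (fps_const (1/2) * Y Fi * (fps_const (1/2) * Y Ei))))"
      by (simp only: Fi gen_def triple_simps v_f_def beta_basis taylor_add taylor_mult
          taylor_Const taylor_Var)
    also have "\<dots> = quad Y"
      unfolding quarter by (subst cancel) (simp_all add: quad_def power2_eq_square mult.commute)
    finally show ?thesis by (simp add: Fi)
  next
    case Hi
    have "taylor (pt X Y) (gen b) = fps_const 2 * (Y Hi * X Hi +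
        fps_const (1/2) * Y Fi * X Ei + fps_const (1/2) * Y Ei * X Fi)"
      by (simp only: Hi gen_def triple_simps v_h_def beta_basis gamma_dual_basis taylor_add
          taylor_mult taylor_Const taylor_Var)
    also have "\<dots> = polar X Y"
      unfolding distrib_left half polar_def by (simp add: mult_ac flip: numeral_fps_const)
    finally show ?thesis by (simp add: Hi)
  qed
qed

definition gen_jet :: "idx \<times> nat \<Rightarrow> var cpoly"
  where "gen_jet = (\<lambda>(b, k). Const (1 / fact k) * (del ^^ k) (gen b))"

lemma peval_gen_jet: "peval (pt X Y) (gen_jet j) = gram X Y j"
proof -
  have "peval (pt X Y) (gen_jet (b, k)) = taylor (pt X Y) (gen b) $ k" for b k
    by (simp add: gen_jet_def taylor_def)
  then show ?thesis by (cases j) (simp add: taylor_gen gram_def)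
qed

text \<open>Makes a polynomial in the Gram coefficients comparable with polynomials in the jet
  variables, where the density argument applies.\<close>

lemma gram_substitution: "\<exists>q. \<forall>X Y. peval (pt X Y) q = peval (gram X Y) G"
proof -
  obtain q where "\<forall>\<sigma>. peval \<sigma> q = peval (\<lambda>j. peval \<sigma> (gen_jet j)) G"
    using peval_substitution[of gen_jet "range gen_jet" G] by (meson hull_inc rangeI)
  then show ?thesis by (intro exI[of _ q]) (simp add: peval_gen_jet)
qed

lemma peval_pt_cancel:
  assumes "\<And>X Y. peval (pt X Y) q \<noteq> 0 \<Longrightarrow> peval (pt X Y) p = peval (pt X Y) p'"
    and "peval (pt X0 Y0) q \<noteq> 0"
  shows "peval (pt X Y) p = peval (pt X Y) p'"
proof -
  have "peval \<sigma> (p - p') = 0" if "peval \<sigma> q \<noteq> 0" for \<sigma>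
    using assms(1) that pt_surj[of \<sigma>] by auto
  then show ?thesis using peval_cancel[of q "p - p'" "pt X0 Y0" "pt X Y"] assms(2) by simp
qed

section \<open>Reduction to a slice\<close>

lemma fps_sqrt_exists:
  assumes "(c :: complex fps) $ 0 \<noteq> 0"
  shows "\<exists>r. r * r = c"
proof -
  have "fps_radical (\<lambda>n. csqrt) (Suc 1) c ^ Suc 1 = c"
    using power_radical[of c "\<lambda>n. csqrt" 1] assms power2_csqrt[of "c $ 0"]
    by (simp add: power2_eq_square)
  then show ?thesis by (auto simp: power2_eq_square)
qed

text \<open>If \<open>w = (w1, w2)\<close> satisfies \<open>Y w = - r w\<close> and \<open>u = X w\<close>, then \<open>X\<close> and \<open>Y\<close> take in the
  basis \<open>u, w\<close> a normal form depending only on \<open>r\<close> and the Gram matrix.\<close>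

lemma peval_slice:
  assumes inv: "\<And>n. act (basis Ei) n P = 0" "\<And>n. act (basis Fi) n P = 0"
    and r: "r * r = quad Y"
    and w: "w1 = Y Hi - r" "w2 = Y Fi"
    and u: "u1 = X Hi * w1 + X Ei * w2" "u2 = X Fi * w1 - X Hi * w2"
    and nz: "(u1 * w2 - u2 * w1) $ 0 \<noteq> 0" "u2 $ 0 \<noteq> 0"
  shows "peval (pt (triple 1 (quad X) 0) (triple 0 (polar X Y) r)) P = peval (pt X Y) P"
proof -
  define D where "D = u1 * w2 - u2 * w1"
  \<comment> \<open>Scaling \<open>u\<close> and \<open>w\<close> by a square root of
    \<open>1 / D\<close> gives the base change determinant 1.\<close>
  obtain l where l: "l * l = inverse D"
    using fps_sqrt_exists[of "inverse D"] nz by (auto simp: D_def)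
  have lD: "l * l * D = 1" unfolding l using nz by (intro inverse_mult_eq_1) (simp add: D_def)
  then have det: "(l * u1) * (l * w2) - (l * w1) * (l * u2) = 1"
    unfolding D_def by (simp add: algebra_simps)
  have "l $ 0 \<noteq> 0" using lD by (metis fps_mult_nth_0 fps_one_nth mult_zero_left zero_neq_one)
  then have l0: "(l * u2) $ 0 \<noteq> 0" using nz by simp
  have r2: "r * r = Y Hi * Y Hi + Y Ei * Y Fi" using r by (simp add: quad_def power2_eq_square)
  let ?c = "conj_arc (l * u1) (l * w1) (l * u2) (l * w2)"
  \<comment> \<open>In the basis \<open>u, w\<close>: \<open>X w = u\<close>, and
    \<open>X u = quad X w\<close> by Cayley-Hamilton.\<close>
  have X: "?c (triple 1 (quad X) 0) = X"
  proof
    fix b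
    have "u1\<^sup>2 - w1\<^sup>2 * quad X = D * X Ei" "w2\<^sup>2 * quad X - u2\<^sup>2 = D * X Fi"
      "w1 * w2 * quad X - u1 * u2 = D * X Hi"
      unfolding D_def u quad_def by (simp_all add: power2_eq_square algebra_simps)
    then have "l * l * (u1\<^sup>2 - w1\<^sup>2 * quad X) = l * l * D * X Ei"
      "l * l * (w2\<^sup>2 * quad X - u2\<^sup>2) = l * l * D * X Fi"
      "l * l * (w1 * w2 * quad X - u1 * u2) = l * l * D * X Hi"
      by (simp_all add: mult.assoc)
    then show "?c (triple 1 (quad X) 0) b = X b"
      unfolding lD by (cases b) (simp_all add: conj_arc_def power2_eq_square algebra_simps)
  qed
  \<comment> \<open>\<open>X Y + Y X\<close> is the scalar \<open>polar X Y\<close>, so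
    \<open>Y w = - r w\<close> implies \<open>Y u = r u + polar X Y w\<close>.\<close>
  have Y: "?c (triple 0 (polar X Y) r) = Y"
  proof
    fix b
    have "- w1\<^sup>2 * polar X Y - 2 * u1 * w1 * r = D * Y Ei"
      "w2\<^sup>2 * polar X Y + 2 * u2 * w2 * r = D * Y Fi"
      "(u1 * w2 + w1 * u2) * r + w1 * w2 * polar X Y = D * Y Hi"
      unfolding D_def u w polar_def using r2 by algebra+
    then have "l * l * (- w1\<^sup>2 * polar X Y - 2 * u1 * w1 * r) = l * l * D * Y Ei"
      "l * l * (w2\<^sup>2 * polar X Y + 2 * u2 * w2 * r) = l * l * D * Y Fi"
      "l * l * ((u1 * w2 + w1 * u2) * r + w1 * w2 * polar X Y) = l * l * D * Y Hi"
      by (simp_all add: mult.assoc)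
    then show "?c (triple 0 (polar X Y) r) b = Y b"
      unfolding lD by (cases b) (simp_all add: conj_arc_def power2_eq_square algebra_simps)
  qed
  show ?thesis
    using peval_conj_arc[OF inv det l0, of "triple 1 (quad X) 0" "triple 0 (polar X Y) r"]
    unfolding X Y by simp
qed

text \<open>With \<open>c = r * r\<close>, the coefficient of \<open>t^k\<close> determines
  \<open>2 r0 rk\<close> from \<open>ck\<close> and earlier coefficients of \<open>r\<close>; the
  power of \<open>r0\<close> clears denominators. The single factor \<open>r0\<close> on the right
  records that \<open>rk\<close> is odd in \<open>r\<close>.\<close>

lemma sqrt_coefficient_eq_gram_polynomial:
  "\<exists>G. \<forall>a b r. r $ 0 \<noteq> 0 \<longrightarrow>
    (r $ 0) ^ (2 * k) * r $ k = r $ 0 * peval (gram (triple 1 a 0) (triple 0 b r)) G"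
proof (induction k rule: less_induct)
  case (less k)
  show ?case
  proof (cases k)
    case 0
    then show ?thesis by (intro exI[of _ 1]) simp
  next
    case (Suc m)
    let ?g = "\<lambda>a b r. gram (triple 1 a 0) (triple 0 b r)"
    have "\<forall>i\<in>{..<k}. \<exists>G. \<forall>a b r. r $ 0 \<noteq> 0 \<longrightarrow>
        (r $ 0) ^ (2 * i) * r $ i = r $ 0 * peval (?g a b r) G"
      using less.IH by blast
    then obtain H where H: "\<And>i a b r. i < k \<Longrightarrow> r $ 0 \<noteq> 0 \<Longrightarrow>
        (r $ 0) ^ (2 * i) * r $ i = r $ 0 * peval (?g a b r) (H i)"
      by (metis (no_types, lifting) bchoice lessThan_iff)
    \<comment> \<open>Each product \<open>H i * H (k - i)\<close> carries the factor
      \<open>r0^(2k - 2)\<close>, which is \<open>c0^m\<close> since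
      \<open>m = k - 1\<close>.\<close>
    let ?G = "Const (1/2) * (Var (Fi, 0) ^ m * Var (Fi, k) - (\<Sum>i=1..m. H i * H (k - i)))"
    have "(r $ 0) ^ (2 * k) * r $ k = r $ 0 * peval (?g a b r) ?G"
      if r: "r $ 0 \<noteq> 0" for a b r
    proof -
      have HH: "peval (?g a b r) (H i) * peval (?g a b r) (H (k - i)) =
          (r $ 0) ^ (2 * m) * (r $ i * r $ (k - i))" if i: "i \<in> {1..m}" for i
      proof -
        have "(r $ 0 * peval (?g a b r) (H i)) * (r $ 0 * peval (?g a b r) (H (k - i))) =
            ((r $ 0) ^ (2 * i) * r $ i) * ((r $ 0) ^ (2 * (k - i)) * r $ (k - i))"
          using H[of i r] H[of "k - i" r] i Suc r by auto
        also have "\<dots> = (r $ 0) ^ (2 * i + 2 * (k - i)) * (r $ i * r $ (k - i))"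
          by (simp add: power_add)
        also have "2 * i + 2 * (k - i) = 2 * m + 2" using i Suc by auto
        finally show ?thesis using r by (simp add: power_add power2_eq_square)
      qed
      have "(r * r) $ k = (\<Sum>i=0..k. r $ i * r $ (k - i))" by (rule fps_mult_nth)
      also have "\<dots> = 2 * r $ 0 * r $ k + (\<Sum>i=1..m. r $ i * r $ (k - i))"
        unfolding Suc by (subst sum.atLeast0_atMost_Suc, subst sum.atLeast_Suc_atMost) simp_all
      finally have c: "(\<Sum>i=1..m. r $ i * r $ (k - i)) = (r * r) $ k - 2 * r $ 0 * r $ k"
        by simp
      have "peval (?g a b r) ?G = ((r $ 0) ^ (2 * m) * (r * r) $ k -
          (\<Sum>i=1..m. (r $ 0) ^ (2 * m) * (r $ i * r $ (k - i)))) / 2"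
        by (simp add: HH quad_def power2_eq_square power_mult flip: power_mult_distrib)
      also have "\<dots> = (r $ 0) ^ (2 * m) * (r $ 0 * r $ k)"
        unfolding sum_distrib_left[symmetric] c by (simp add: algebra_simps)
      finally show ?thesis unfolding Suc by (simp add: mult_ac)
    qed
    then show ?thesis by blast
  qed
qed

text \<open>\<open>G1\<close> and \<open>G2\<close> give the even and the odd part in
  \<open>r\<close>. Such expressions are closed under sums, over a common denominator, and under
  products, where \<open>r0^2 = c0\<close> is absorbed into the even part.\<close>

lemma peval_slice_eq_gram_polynomials:
  "\<exists>M G1 G2. \<forall>a b r. r $ 0 \<noteq> 0 \<longrightarrow>
    (r $ 0) ^ (2 * M) * peval (pt (triple 1 a 0) (triple 0 b r)) P =
    peval (gram (triple 1 a 0) (triple 0 b r)) G1 +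
    r $ 0 * peval (gram (triple 1 a 0) (triple 0 b r)) G2"
proof (induction P rule: cpoly_induct)
  let ?s = "\<lambda>a b r. pt (triple 1 a 0) (triple 0 b r)"
  let ?g = "\<lambda>a b r. gram (triple 1 a 0) (triple 0 b r)"
  let ?c = "Var (Fi, 0 :: nat)"
  have c: "peval (?g a b r) ?c = (r $ 0)\<^sup>2" for a b r
    by (simp add: quad_def power2_eq_square)
  {
    case (add P Q)
    then obtain M G1 G2 N H1 H2 where
      P: "\<And>a b r. r $ 0 \<noteq> 0 \<Longrightarrow> (r $ 0) ^ (2 * M) * peval (?s a b r) P =
        peval (?g a b r) G1 + r $ 0 * peval (?g a b r) G2" and
      Q: "\<And>a b r. r $ 0 \<noteq> 0 \<Longrightarrow> (r $ 0) ^ (2 * N) * peval (?s a b r) Q =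
        peval (?g a b r) H1 + r $ 0 * peval (?g a b r) H2" by meson
    have "(r $ 0) ^ (2 * (M + N)) * peval (?s a b r) (P + Q) =
        peval (?g a b r) (?c ^ N * G1 + ?c ^ M * H1) +
        r $ 0 * peval (?g a b r) (?c ^ N * G2 + ?c ^ M * H2)" if r: "r $ 0 \<noteq> 0" for a b r
    proof -
      have "(r $ 0) ^ (2 * (M + N)) * peval (?s a b r) (P + Q) =
          (r $ 0) ^ (2 * N) * ((r $ 0) ^ (2 * M) * peval (?s a b r) P) +
          (r $ 0) ^ (2 * M) * ((r $ 0) ^ (2 * N) * peval (?s a b r) Q)"
        by (simp add: power_add algebra_simps)
      also have "\<dots> = peval (?g a b r) (?c ^ N * G1 + ?c ^ M * H1) +
          r $ 0 * peval (?g a b r) (?c ^ N * G2 + ?c ^ M * H2)"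
        unfolding P[OF r] Q[OF r] unfolding peval_add peval_mult peval_power c power_mult
        by (simp only: algebra_simps)
      finally show ?thesis .
    qed
    then show ?case by blast
  next
    case (Const c)
    show ?case by (intro exI[of _ 0] exI[of _ "Const c"] exI[of _ 0]) simp
  next
    case (Var v)
    show ?case
    proof (cases v)
      case (Gamma k b)
      show ?thesis unfolding Gamma
        by (intro exI[of _ 0] exI[of _ "Const (fact k) *
          triple (Const ((1 :: complex fps) $ k)) (Var (Ei, k)) 0 b"] exI[of _ 0])
          (cases b; simp add: quad_def)
    next
      case (Beta k b)
      show ?thesis
      proof (cases b)
        case Ei
        show ?thesis unfolding Beta Ei
          by (intro exI[of _ 0] exI[of _ "Const (fact k / 2) * Var (Hi, k)"] exI[of _ 0])
            (simp add: polar_def)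
      next
        case Fi
        show ?thesis unfolding Beta Fi by (intro exI[of _ 0]) simp
      next
        case Hi
        obtain G where "\<And>a b r. r $ 0 \<noteq> 0 \<Longrightarrow>
            (r $ 0) ^ (2 * k) * r $ k = r $ 0 * peval (?g a b r) G"
          using sqrt_coefficient_eq_gram_polynomial[of k] by blast
        then show ?thesis unfolding Beta Hi
          by (intro exI[of _ k] exI[of _ 0] exI[of _ "Const (fact k) * G"]) (simp add: mult_ac)
      qed
    qed
  next
    case (mult P Q)
    then obtain M G1 G2 N H1 H2 where
      P: "\<And>a b r. r $ 0 \<noteq> 0 \<Longrightarrow> (r $ 0) ^ (2 * M) * peval (?s a b r) P =
        peval (?g a b r) G1 + r $ 0 * peval (?g a b r) G2" and
      Q: "\<And>a b r. r $ 0 \<noteq> 0 \<Longrightarrow> (r $ 0) ^ (2 * N) * peval (?s a b r) Q =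
        peval (?g a b r) H1 + r $ 0 * peval (?g a b r) H2" by meson
    have "(r $ 0) ^ (2 * (M + N)) * peval (?s a b r) (P * Q) =
        peval (?g a b r) (G1 * H1 + ?c * (G2 * H2)) +
        r $ 0 * peval (?g a b r) (G1 * H2 + G2 * H1)" if r: "r $ 0 \<noteq> 0" for a b r
    proof -
      have "(r $ 0) ^ (2 * (M + N)) * peval (?s a b r) (P * Q) =
          ((r $ 0) ^ (2 * M) * peval (?s a b r) P) * ((r $ 0) ^ (2 * N) * peval (?s a b r) Q)"
        by (simp add: power_add algebra_simps)
      also have "\<dots> = peval (?g a b r) (G1 * H1 + ?c * (G2 * H2)) +
          r $ 0 * peval (?g a b r) (G1 * H2 + G2 * H1)"
        unfolding P[OF r] Q[OF r] peval_add peval_mult c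
        by (simp add: power2_eq_square algebra_simps)
      finally show ?thesis .
    qed
    then show ?case by blast
  }
qed

text \<open>Where \<open>peval_slice\<close> applies to both square roots, the slice formula gives
  the claim with \<open>G = G1\<close>; density extends it to all pairs.\<close>

lemma invariant_times_power_eq_gram_polynomial:
  assumes inv: "\<And>n. act (basis Ei) n P = 0" "\<And>n. act (basis Fi) n P = 0"
  shows "\<exists>M G. \<forall>X Y. (quad Y $ 0) ^ M * peval (pt X Y) P = peval (gram X Y) G"
proof -
  obtain M G1 G2 where G: "\<And>a b r. r $ 0 \<noteq> 0 \<Longrightarrow>
      (r $ 0) ^ (2 * M) * peval (pt (triple 1 a 0) (triple 0 b r)) P =
      peval (gram (triple 1 a 0) (triple 0 b r)) G1 +
      r $ 0 * peval (gram (triple 1 a 0) (triple 0 b r)) G2"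
    using peval_slice_eq_gram_polynomials[of P] by meson
  \<comment> \<open>The factors 2 and the exchange of \<open>Ei\<close> and \<open>Fi\<close> undo
    those in \<open>pt\<close>.\<close>
  define y where "y = triple (Const 2 * Var (Beta 0 Fi)) (Const 2 * Var (Beta 0 Ei)) (Var (Beta 0 Hi))"
  define x where "x b = Var (Gamma 0 b)" for b
  have x: "peval (pt X Y) (x b) = X b $ 0" and y: "peval (pt X Y) (y b) = Y b $ 0" for X Y b
    by (cases b; simp add: x_def y_def)+
  define c where "c = y Hi * y Hi + y Ei * y Fi"
  \<comment> \<open>The constant term of \<open>u1 * w2 - u2 * w1\<close> is
    \<open>A + B * r0\<close>, and that of \<open>u2\<close> is
    \<open>C - x Fi * r0\<close>.\<close>
  define A where "A = Const 2 * x Hi * y Hi * y Fi + x Ei * y Fi * y Fi -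
    x Fi * (Const 2 * y Hi * y Hi + y Ei * y Fi)"
  define B where "B = Const 2 * (x Fi * y Hi - x Hi * y Fi)"
  define C where "C = x Fi * y Hi - x Hi * y Fi"
  \<comment> \<open>Up to the factor \<open>c\<close>, this is the product of the values at \<open>r\<close> and at \<open>- r\<close> of the two
    quantities required to be nonzero in \<open>peval_slice\<close>.\<close>
  define \<Delta> where "\<Delta> = c * (A * A - B * B * c) * (C * C - x Fi * x Fi * c)"
  obtain q where q: "\<And>X Y. peval (pt X Y) q = peval (gram X Y) G1"
    using gram_substitution by blast
  have c: "peval (pt X Y) c = quad Y $ 0" for X Y
    by (simp add: c_def y quad_def power2_eq_square)
  have slice: "(quad Y $ 0) ^ M * peval (pt X Y) P =
      peval (gram X Y) G1 + r $ 0 * peval (gram X Y) G2"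
    if \<Delta>: "peval (pt X Y) \<Delta> \<noteq> 0" and r: "r * r = quad Y" for X Y r
  proof -
    define w1 where "w1 = Y Hi - r"
    define w2 where "w2 = Y Fi"
    define u1 where "u1 = X Hi * w1 + X Ei * w2"
    define u2 where "u2 = X Fi * w1 - X Hi * w2"
    have r0: "r $ 0 * r $ 0 = quad Y $ 0" using r by (metis fps_mult_nth_0)
    then have r0': "r $ 0 * r $ 0 = Y Hi $ 0 * Y Hi $ 0 + Y Ei $ 0 * Y Fi $ 0"
      by (simp add: quad_def power2_eq_square)
    have "peval (pt X Y) (A * A - B * B * c) =
        (u1 * w2 - u2 * w1) $ 0 * (peval (pt X Y) A - peval (pt X Y) B * r $ 0)"
    proof -
      have "(u1 * w2 - u2 * w1) $ 0 = peval (pt X Y) A + peval (pt X Y) B * r $ 0"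
        unfolding A_def B_def u1_def u2_def w1_def w2_def using r0'
        by (simp add: x y) algebra
      then show ?thesis using r0 by (simp add: c algebra_simps)
    qed
    then have nz1: "(u1 * w2 - u2 * w1) $ 0 \<noteq> 0" using \<Delta> by (auto simp: \<Delta>_def)
    have "peval (pt X Y) (C * C - x Fi * x Fi * c) =
        u2 $ 0 * (peval (pt X Y) C + X Fi $ 0 * r $ 0)"
    proof -
      have "u2 $ 0 = peval (pt X Y) C - X Fi $ 0 * r $ 0"
        unfolding C_def u2_def w1_def w2_def by (simp add: x y algebra_simps)
      then show ?thesis unfolding peval_diff peval_mult c x using r0 by algebra
    qed
    then have nz2: "u2 $ 0 \<noteq> 0" using \<Delta> by (auto simp: \<Delta>_def)
    have "r $ 0 \<noteq> 0" using \<Delta> r0 by (auto simp: \<Delta>_def c)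
    note G[OF this, of "quad X" "polar X Y"]
    moreover have "gram (triple 1 (quad X) 0) (triple 0 (polar X Y) r) = gram X Y"
      using r by (auto simp: gram_def quad_def polar_def fun_eq_iff triple_def power2_eq_square
          split: idx.splits)
    moreover have "(r $ 0) ^ (2 * M) = (quad Y $ 0) ^ M"
      using r0 by (simp add: power_mult power2_eq_square)
    ultimately show ?thesis
      using peval_slice[OF inv r w1_def w2_def u1_def u2_def nz1 nz2] by simp
  qed
  have main: "peval (pt X Y) (c ^ M * P) = peval (pt X Y) q" for X Y
  proof (rule peval_pt_cancel)
    fix X Y assume \<Delta>: "peval (pt X Y) \<Delta> \<noteq> 0"
    then have "quad Y $ 0 \<noteq> 0" by (auto simp: \<Delta>_def c)
    then obtain r where r: "r * r = quad Y" using fps_sqrt_exists by blast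
    \<comment> \<open>Both square roots \<open>r\<close> and \<open>- r\<close> are admissible, so the odd part vanishes.\<close>
    have "2 * ((quad Y $ 0) ^ M * peval (pt X Y) P) = 2 * peval (gram X Y) G1"
      using slice[OF \<Delta> r] slice[OF \<Delta>, of "- r"] r by simp
    then show "peval (pt X Y) (c ^ M * P) = peval (pt X Y) q" by (simp add: c q)
  next
    \<comment> \<open>At \<open>X = e + h\<close>, \<open>Y = f + h\<close> one has
      \<open>c = 1\<close>, \<open>A = 3\<close>, \<open>B = - 2\<close>, \<open>C = - 1\<close>, so
      \<open>\<Delta>\<close> takes the value 5.\<close>
    show "peval (pt (triple 1 0 1) (triple 0 1 1)) \<Delta> \<noteq> 0"
      by (simp add: \<Delta>_def A_def B_def C_def c_def x y)
  qed
  show ?thesis using main by (intro exI[of _ M] exI[of _ G1]) (simp add: c q)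
qed

text \<open>One factor \<open>c0\<close> is removed at a time: \<open>G\<close> vanishes on a dense
  part of \<open>c0 = 0\<close>, hence is divisible by \<open>c0\<close>.\<close>

lemma gram_polynomial_divide_power:
  assumes "\<And>X Y. (quad Y $ 0) ^ M * peval (pt X Y) P = peval (gram X Y) G"
  shows "\<exists>G'. \<forall>X Y. peval (pt X Y) P = peval (gram X Y) G'"
  using assms
proof (induction M arbitrary: G)
  case 0
  then show ?case by auto
next
  case (Suc M)
  obtain G0 where G0: "\<And>\<tau>. peval \<tau> G0 = peval (\<tau>((Fi, 0) := 0)) G"
    using peval_set_variable_0[of "(Fi, 0)" G] by blast
  \<comment> \<open>Every jet with \<open>a\<^sub>0 \<noteq> 0\<close> and \<open>c\<^sub>0 = 0\<close> is a Gram matrix.\<close>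
  have "peval \<tau> G0 = 0" if "peval \<tau> (Var (Ei, 0)) \<noteq> 0" for \<tau>
  proof -
    define a where "a = Abs_fps (\<lambda>k. \<tau> (Ei, k))"
    define b where "b = Abs_fps (\<lambda>k. \<tau> (Hi, k))"
    define c where "c = Abs_fps (\<lambda>k. (\<tau>((Fi, 0) := 0)) (Fi, k))"
    obtain s where s: "s * s = a" using fps_sqrt_exists[of a] \<open>peval \<tau> _ \<noteq> 0\<close> by (auto simp: a_def)
    \<comment> \<open>This is the slice with \<open>X\<close> and \<open>Y\<close> exchanged,
      \<open>X = b f + s h\<close> and \<open>Y = e + c f\<close>; it needs a root of
      \<open>a\<close> instead of \<open>c\<close>.\<close>
    have "gram (triple 0 b s) (triple 1 c 0) j = (\<tau>((Fi, 0) := 0)) j" for j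
    proof -
      obtain i k where "j = (i, k)" by force
      then show ?thesis using s
        by (cases i) (simp_all add: quad_def polar_def power2_eq_square a_def b_def c_def)
    qed
    then have "peval \<tau> G0 = peval (gram (triple 0 b s) (triple 1 c 0)) G"
      unfolding G0 by presburger
    also have "\<dots> = 0"
      using Suc.prems[of "triple 1 c 0" "triple 0 b s"] by (simp add: quad_def c_def)
    finally show ?thesis .
  qed
  then have "peval \<tau> G0 = 0" for \<tau>
    using peval_cancel[of "Var (Ei, 0)" G0 "\<lambda>_. 1"] by simp
  moreover obtain G' where
    "\<And>\<tau>. peval \<tau> G - peval (\<tau>((Fi, 0) := 0)) G = \<tau> (Fi, 0) * peval \<tau> G'"
    using peval_split_variable[of G "(Fi, 0)"] by blast
  ultimately have G': "peval (gram X Y) G = quad Y $ 0 * peval (gram X Y) G'" for X Y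
    unfolding G0[symmetric] by simp
  obtain q where q: "\<And>X Y. peval (pt X Y) q = peval (gram X Y) G'"
    using gram_substitution by blast
  have c: "peval (pt X Y) (gen_jet (Fi, 0)) = quad Y $ 0" for X Y
    by (simp add: peval_gen_jet)
  \<comment> \<open>Cancelling \<open>c0\<close> is valid where it is nonzero, for instance at
    \<open>Y = h\<close>, and extends by density.\<close>
  have "peval (pt X Y) (gen_jet (Fi, 0) ^ M * P) = peval (pt X Y) q" for X Y
  proof (rule peval_pt_cancel)
    fix X Y assume "peval (pt X Y) (gen_jet (Fi, 0)) \<noteq> 0"
    then show "peval (pt X Y) (gen_jet (Fi, 0) ^ M * P) = peval (pt X Y) q"
      using Suc.prems[of Y X] by (simp add: c q G')
  next
    show "peval (pt (\<lambda>_. 0) (triple 0 0 1)) (gen_jet (Fi, 0)) \<noteq> 0"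
      by (simp add: c quad_def)
  qed
  then show ?case using Suc.IH[of G'] by (simp add: c q)
qed

lemma invariant_eq_gram_polynomial:
  assumes "\<And>n. act (basis Ei) n P = 0" "\<And>n. act (basis Fi) n P = 0"
  shows "\<exists>G. \<forall>\<sigma>. peval \<sigma> P = peval (\<lambda>j. peval \<sigma> (gen_jet j)) G"
proof -
  obtain G where "\<And>X Y. peval (pt X Y) P = peval (gram X Y) G"
    using invariant_times_power_eq_gram_polynomial[OF assms] gram_polynomial_divide_power by meson
  then have "peval \<sigma> P = peval (\<lambda>j. peval \<sigma> (gen_jet j)) G" for \<sigma>
    using pt_surj[of \<sigma>] by (auto simp: peval_gen_jet)
  then show ?thesis by blast
qed

section \<open>Invariance of the generators\<close>

lemma Ccoeff_Suc: "m \<le> k \<Longrightarrow> Ccoeff k (Suc m) = of_nat (k - m) * Ccoeff k m"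
  by (auto simp: Ccoeff_def)

text \<open>Pascal rule for falling factorials.\<close>

lemma Ccoeff_Suc_Suc: "Ccoeff (Suc k) (Suc m) = Ccoeff k (Suc m) + of_nat (Suc m) * Ccoeff k m"
proof (cases "m \<le> k")
  case True
  have "(\<Prod>i<Suc m. Suc k - i) = Suc k * (\<Prod>i<m. k - i)"
    by (subst prod.lessThan_Suc_shift) simp
  then have "Ccoeff (Suc k) (Suc m) = of_nat (Suc k) * Ccoeff k m"
    using True unfolding Ccoeff_def by (simp only: of_nat_mult) simp
  also have "(of_nat (Suc k) :: complex) = of_nat (k - m) + of_nat (Suc m)"
    using True by (simp flip: of_nat_add)
  finally show ?thesis
    unfolding Ccoeff_Suc[OF True] by (simp only: distrib_right)
qed (simp add: Ccoeff_def)

text \<open>On variables this is the Pascal rule, and both sides follow the same product rule. For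
  \<open>n = 0\<close> the truncated \<open>n - 1\<close> is multiplied by 0.\<close>

lemma act_del: "act u n (del p) = del (act u n p) + Const (of_nat n) * act u (n - 1) p"
proof (induction p rule: cpoly_induct)
  case (Var v)
  have shift: "Ccoeff (Suc k) n = Ccoeff k n + of_nat n * Ccoeff k (n - 1)" for k
    by (cases n) (simp_all add: Ccoeff_Suc_Suc del: of_nat_Suc, simp add: Ccoeff_def)
  have eq: "Const (Ccoeff (Suc k) n) * f (Suc k - n) = Const (Ccoeff k n) * f (Suc (k - n)) +
      Const (of_nat n) * (Const (Ccoeff k (n - 1)) * f (k - (n - 1)))" for k and f :: "nat \<Rightarrow> var cpoly"
  proof -
    have 1: "Const (Ccoeff k n) * f (Suc (k - n)) = Const (Ccoeff k n) * f (Suc k - n)"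
      by (cases "n \<le> k") (simp_all add: Suc_diff_le Ccoeff_def)
    have 2: "of_nat n * Ccoeff k (n - 1) = 0 \<or> k - (n - 1) = Suc k - n"
      by (cases n) auto
    have 3: "Const (of_nat n) * (Const (Ccoeff k (n - 1)) * f j) =
        Const (of_nat n * Ccoeff k (n - 1)) * f j" for j
      by (simp add: Const_mult mult.assoc)
    show ?thesis unfolding 1 3 shift Const_add distrib_right
      using 2 by (auto simp del: mult_eq_0_iff)
  qed
  have Const_mult: "del (Const c * p) = Const c * del p" for c p
    by (simp add: del_mult)
  have Var: "act u n (Var w) = act_var u n w" "del (Var w) = shift_var w" for n w
    by (simp_all add: act_def del_def)
  show ?case
  proof (cases v)
    case (Beta k b)
    then show ?thesis using eq[of k "\<lambda>j. beta j (bracket u (basis b))"]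
      by (simp add: Var Const_mult del_beta)
  next
    case (Gamma k b)
    then show ?thesis using eq[of k "\<lambda>j. gamma j (coad u (dual_basis b))"]
      by (simp add: Var Const_mult del_gamma)
  qed
next
  case (Const c)
  show ?case using del_Const[of 0] act_Const[of u n 0] by simp
qed (simp_all add: act_add act_mult del_add del_mult algebra_simps)

text \<open>Commuting with \<open>del\<close> only produces lower powers of \<open>t\<close>, so the
  induction treats all \<open>n\<close> together.\<close>

lemma act_del_funpow:
  assumes "\<And>n. act u n p = 0"
  shows "act u n ((del ^^ k) p) = 0"
proof (induction k arbitrary: n)
  case (Suc k)
  then show ?case using del_Const[of 0] by (simp add: act_del)
qed (simp add: assms)

text \<open>For \<open>n > 0\<close> all variables of level zero are killed; for
  \<open>n = 0\<close> this is invariance of the two quadratic forms and of the pairing, checked on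
  values.\<close>

lemma act_generators:
  assumes "u \<in> sl2" "v \<in> {v_e, v_f, v_h}"
  shows "act u n v = 0"
proof (rule cpoly_eqI)
  fix \<sigma>
  have u: "vec_nth (vec_nth u 2) 2 = - vec_nth (vec_nth u 1) 1"
    using assms(1) by (simp add: sl2_def trace_def sum_2 add_eq_0_iff)
  have "peval \<sigma> (2 :: var cpoly) = 2" using peval_add[of \<sigma> 1 1] by simp
  note u = u this
  show "peval \<sigma> (act u n v) = peval \<sigma> 0"
  proof (cases n)
    case 0
    then show ?thesis using assms(2)
      by (auto simp: v_e_def v_f_def v_h_def beta_basis gamma_dual_basis act_add act_mult
          simp del: basis.simps dual_basis.simps)
        (auto simp: act_def beta_def gamma_def coad_def bracket_def Ccoeff_def
          matrix_matrix_mult_def sum_2 u algebra_simps)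
  next
    case (Suc m)
    then have "act u n (Var (Beta 0 b)) = 0" "act u n (Var (Gamma 0 b)) = 0" for b
      by (simp_all add: act_def Ccoeff_def)
    then show ?thesis using assms(2)
      by (auto simp: v_e_def v_f_def v_h_def beta_basis gamma_dual_basis act_add act_mult
          simp del: basis.simps dual_basis.simps)
  qed
qed

lemma subalgebra_P_Theta_invariants: "subalgebra P_Theta_invariants"
  by (auto simp: subalgebra_def P_Theta_invariants_def act_add act_mult)

lemma subalgebra_P0_sl2_invariants: "subalgebra P0_sl2_invariants"
  by (auto simp: subalgebra_def P0_sl2_invariants_def P0_def act_add act_mult
      subalgebra_hull_closed)

section \<open>Polynomials of level zero\<close>

lemma generators_in_P0: "{v_e, v_f, v_h} \<subseteq> P0"
proof -
  have *: "beta0 b \<in> P0" "gamma0 b \<in> P0" for b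
    unfolding P0_def by (auto intro!: hull_inc basis_sl2 dual_basis_sl2_dual)
  have "Const c \<in> P0" "p \<in> P0 \<Longrightarrow> q \<in> P0 \<Longrightarrow> p + q \<in> P0" "p \<in> P0 \<Longrightarrow> q \<in> P0 \<Longrightarrow> p * q \<in> P0"
    for c p q unfolding P0_def by (simp_all add: subalgebra_hull_closed)
  with * show ?thesis unfolding v_e_def v_f_def v_h_def
    by (auto simp del: basis.simps dual_basis.simps)
qed

lemma act_P0:
  assumes "p \<in> P0" "0 < n"
  shows "act u n p = 0"
  using assms(1) unfolding P0_def
proof (rule hull_induct)
  fix q assume "q \<in> beta 0 ` sl2 \<union> gamma 0 ` sl2_dual"
  then show "act u n q = 0" using assms(2) by (auto simp: act_beta act_gamma Ccoeff_def)
qed (auto simp: subalgebra_def act_add act_mult)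

fun level0 :: "(var \<Rightarrow> complex) \<Rightarrow> var \<Rightarrow> complex" where
  "level0 \<sigma> (Beta k b) = (if k = 0 then \<sigma> (Beta 0 b) else 0)"
| "level0 \<sigma> (Gamma k b) = (if k = 0 then \<sigma> (Gamma 0 b) else 0)"

lemma peval_level0:
  assumes "p \<in> P0"
  shows "peval (level0 \<sigma>) p = peval \<sigma> p"
  using assms unfolding P0_def
proof (rule hull_induct)
  fix q assume "q \<in> beta 0 ` sl2 \<union> gamma 0 ` sl2_dual"
  then show "peval (level0 \<sigma>) q = peval \<sigma> q" by (auto simp: beta_def gamma_def)
qed (auto simp: subalgebra_def)

text \<open>Setting the variables of positive level to zero replaces both arcs by their constant
  terms, and the Gram entries of constant arcs are constant.\<close>

lemma peval_level0_gen_jet: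
  "peval (level0 \<sigma>) (gen_jet (b, k)) = (if k = 0 then peval \<sigma> (gen b) else 0)"
proof -
  obtain X Y where \<sigma>: "\<sigma> = pt X Y" using pt_surj by blast
  define X0 where "X0 b = fps_const (X b $ 0)" for b
  define Y0 where "Y0 b = fps_const (Y b $ 0)" for b
  have "level0 \<sigma> = pt X0 Y0"
  proof
    fix v show "level0 \<sigma> v = pt X0 Y0 v"
    proof (cases v)
      case (Beta k c)
      then show ?thesis by (cases c) (simp_all add: \<sigma> X0_def Y0_def)
    qed (simp add: \<sigma> X0_def Y0_def)
  qed
  then have "peval (level0 \<sigma>) (gen_jet (b, k)) = gram X0 Y0 (b, k)"
    by (simp add: peval_gen_jet)
  also have "\<dots> = (if k = 0 then gram X Y (b, 0) else 0)"
    by (cases b) (simp_all add: quad_def polar_def X0_def Y0_def numeral_fps_const power2_eq_square)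
  also have "gram X Y (b, 0) = peval \<sigma> (gen b)"
    unfolding \<sigma> peval_gen_jet[symmetric] by (simp add: gen_jet_def)
  finally show ?thesis .
qed

section \<open>Generation of both invariant rings\<close>

theorem theorem5p2:
  shows "generates_ring {v_e, v_f, v_h} P0_sl2_invariants \<and>
    generates_diff_ring del {v_e, v_f, v_h} P_Theta_invariants"
proof
  let ?S = "{v_e, v_f, v_h}"
  let ?T = "{(del ^^ k) a | k a. a \<in> ?S}"
  have gen: "gen b \<in> subalgebra hull ?S" for b
    unfolding gen_def
    by (cases b) (simp_all add: subalgebra_hull_closed hull_inc)
  have gen_jet: "gen_jet (b, k) \<in> subalgebra hull ?T" for b k
  proof -
    obtain c v where "gen b = Const c * v" "v \<in> ?S"
      by (cases b) (auto simp: gen_def)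
    then have eq: "gen_jet (b, k) = Const (1 / fact k) * (Const c * (del ^^ k) v)"
      and "(del ^^ k) v \<in> ?T"
      by (auto simp: gen_jet_def del_funpow_Const_mult)
    then have "(del ^^ k) v \<in> subalgebra hull ?T" by (simp only: hull_inc)
    then show ?thesis unfolding eq by (intro subalgebra_hull_closed)
  qed
  have Gram: "\<exists>G. \<forall>\<sigma>. peval \<sigma> p = peval (\<lambda>j. peval \<sigma> (gen_jet j)) G"
    if "p \<in> P_Theta_invariants" for p
    using that invariant_eq_gram_polynomial[of p] basis_sl2
    unfolding P_Theta_invariants_def by blast
  show "generates_diff_ring del ?S P_Theta_invariants"
    unfolding generates_diff_ring_def generates_ring_def
  proof
    show "subalgebra hull ?T \<subseteq> P_Theta_invariants"
    proof (rule hull_minimal)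
      show "subalgebra P_Theta_invariants" by (rule subalgebra_P_Theta_invariants)
      show "?T \<subseteq> P_Theta_invariants"
        using act_del_funpow act_generators unfolding P_Theta_invariants_def by blast
    qed
    show "P_Theta_invariants \<subseteq> subalgebra hull ?T"
    proof
      fix p assume "p \<in> P_Theta_invariants"
      then obtain G where G: "\<And>\<sigma>. peval \<sigma> p = peval (\<lambda>j. peval \<sigma> (gen_jet j)) G"
        using Gram by blast
      obtain q where "q \<in> subalgebra hull ?T"
        "\<And>\<sigma>. peval \<sigma> q = peval (\<lambda>j. peval \<sigma> (gen_jet j)) G"
        using peval_substitution[of gen_jet ?T G] gen_jet by auto
      then show "p \<in> subalgebra hull ?T" using cpoly_eqI[of p q] G by simp
    qed
  qed
  show "generates_ring ?S P0_sl2_invariants"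
    unfolding generates_ring_def
  proof
    show "subalgebra hull ?S \<subseteq> P0_sl2_invariants"
    proof (rule hull_minimal)
      show "subalgebra P0_sl2_invariants" by (rule subalgebra_P0_sl2_invariants)
      show "?S \<subseteq> P0_sl2_invariants"
        using generators_in_P0 act_generators unfolding P0_sl2_invariants_def by blast
    qed
    show "P0_sl2_invariants \<subseteq> subalgebra hull ?S"
    proof
      fix p assume p: "p \<in> P0_sl2_invariants"
      then have P0: "p \<in> P0" by (simp add: P0_sl2_invariants_def)
      \<comment> \<open>Positive powers of \<open>t\<close> annihilate \<open>P0\<close>, so
        \<open>p\<close> is invariant under the whole current algebra.\<close>
      have "act u n p = 0" if "u \<in> sl2" for u n
        using p that act_P0[OF P0, of n u] by (cases "n = 0") (auto simp: P0_sl2_invariants_def)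
      then have "p \<in> P_Theta_invariants" by (simp add: P_Theta_invariants_def)
      then obtain G where G: "\<And>\<sigma>. peval \<sigma> p = peval (\<lambda>j. peval \<sigma> (gen_jet j)) G"
        using Gram by blast
      \<comment> \<open>These are the values of the jets once positive levels are set to zero, which
        leaves \<open>p\<close> unchanged.\<close>
      define W where "W = (\<lambda>(b, k :: nat). if k = 0 then gen b else Const 0)"
      have "W j \<in> subalgebra hull ?S" for j
        using gen subalgebra_hull_closed(1)[of 0 ?S] by (auto simp: W_def split: prod.split)
      then obtain q where q: "q \<in> subalgebra hull ?S"
        "\<And>\<sigma>. peval \<sigma> q = peval (\<lambda>j. peval \<sigma> (W j)) G"
        using peval_substitution[of W ?S G] by auto
      have "peval \<sigma> (W j) = peval (level0 \<sigma>) (gen_jet j)" for \<sigma> j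
        by (cases j) (simp add: W_def peval_level0_gen_jet)
      then have "peval \<sigma> p = peval \<sigma> q" for \<sigma>
        using G[of "level0 \<sigma>"] q(2)[of \<sigma>] peval_level0[OF P0, of \<sigma>] by simp
      then show "p \<in> subalgebra hull ?S" using cpoly_eqI[of p q] q(1) by simp
    qed
  qed
qed

end
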